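(* In the perturbative BF theory in $\mathbb{R}^3$ (see context), the tree-level part $W_0[J,K]$ of the generating functional of connected correlation functions of the connection is given by $$W_0[J,K]=g\,S_{CS}[\widehat A\,]+\int d^3x\,J^a_\mu(x)\,\widehat A^a_\mu(x),$$ where $\widehat A^a_\mu$ is a classical field which depends only on $K$, and which satisfies $\partial^\mu\widehat A^a_\mu(x)=0$ and $$\frac{\delta S_{CS}[\widehat A\,]}{\delta\widehat A^a_\mu(x)}=-K^a_\mu(x).$$
   Context: Colour indices $a,b,c\in\{1,2,3\}$ and Euclidean vector indices $\mu,\nu,\lambda\in\{1,2,3\}$ are summed when repeated. $A^a_\mu,B^a_\mu$ are fields on $\mathbb{R}^3$, $g$ is a real coupling constant, $J^a_\mu,K^a_\mu$ are localized classical sources. Set $F^a_{\mu\nu}(A)=\partial_\mu A^a_\nu-\partial_\nu A^a_\mu-\epsilon^{abc}A^b_\mu A^c_\nu$. The Chern-Simons action and the BF action are $$S_{CS}[A]=\int d^3x\,\epsilon^{\mu\nu\lambda}\big[\tfrac12A^a_\mu\partial_\nu A^a_\lambda-\tfrac16\epsilon^{abc}A^a_\mu A^b_\nu A^c_\lambda\big],\qquad S[A,B]=\int d^3x\,\epsilon^{\mu\nu\lambda}\,\tfrac12B^a_\mu F^a_{\nu\lambda}(A)+g\,S_{CS}[A].$$ The quantum theory is gauge-fixed in the Landau gauge $\partial^\mu A^a_\mu=0=\partial^\mu B^a_\mu$. The functional $W_0[J,K]$ (the sum of the connected tree-level Feynman diagrams with sources $J$ coupled to $A$ and $K$ coupled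 to $B$) is described by the Legendre transformation of the classical action $$W_0[J,K]=S[\widehat A,\widehat B]+\int d^3x\,\big[J^a_\mu\widehat A^a_\mu+K^a_\mu\widehat B^a_\mu\big],$$ where the classical components $\widehat A^a_\mu,\widehat B^a_\mu$ are the functions of the sources (determined perturbatively in the sources, vanishing as $1/|x|^2$ when $|x|\to\infty$) that satisfy the equations of motion in the presence of the sources $$\frac{\delta S[\widehat A,\widehat B]}{\delta\widehat B^a_\mu(x)}+K^a_\mu(x)=0,\qquad\frac{\delta S[\widehat A,\widehat B]}{\delta\widehat A^a_\mu(x)}+J^a_\mu(x)=0,$$ together with $\partial^\mu\widehat A^a_\mu=0=\partial^\mu\widehat B^a_\mu$. *)

theory Defs
  imports "HOL-Analysis.Analysis" "HOL-Computational_Algebra.Formal_Power_Series"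
    "HOL-Library.Landau_Symbols"
begin

text \<open>
  Perturbation theory in the sources is rendered by formal power series in one real bookkeeping
  parameter \<open>t\<close> that counts powers of the sources.  A field assigns to a colour index, a vector
  index and a point of Euclidean 3-space a formal power series in \<open>t\<close>; derivatives and integrals
  act on the coefficients, products are products of formal power series.  Sources start at
  order \<open>t\<close>.  The sources \<open>t * j\<close>, \<open>t * k\<close>, with \<open>j\<close>, \<open>k\<close> ordinary functions, give the expansion
  in powers of \<open>j\<close>, \<open>k\<close>.  Sources with higher orders in \<open>t\<close> are allowed as well, because the
  equations of motion force the source of the second field to be covariantly conserved with
  respect to the connection, which a source proportional to \<open>t\<close> satisfies only exceptionally.
\<close>

type_synonym field = "3 \<Rightarrow> 3 \<Rightarrow> real^3 \<Rightarrow> real fps"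

definition levi_civita :: "3 \<Rightarrow> 3 \<Rightarrow> 3 \<Rightarrow> real" where
  "levi_civita a b c =
     (if (a, b, c) \<in> {(1, 2, 3), (2, 3, 1), (3, 1, 2)} then 1
      else if (a, b, c) \<in> {(1, 3, 2), (3, 2, 1), (2, 1, 3)} then -1
      else 0)"

definition partial :: "3 \<Rightarrow> (real^3 \<Rightarrow> real) \<Rightarrow> real^3 \<Rightarrow> real" where
  "partial \<nu> f x = frechet_derivative f (at x) (axis \<nu> 1)"

definition smooth :: "(real^3 \<Rightarrow> real) \<Rightarrow> bool" where
  "smooth f \<longleftrightarrow> (\<forall>\<nu>s x. foldr partial \<nu>s f differentiable at x)"

definition fpartial :: "3 \<Rightarrow> (real^3 \<Rightarrow> real fps) \<Rightarrow> real^3 \<Rightarrow> real fps" where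
  "fpartial \<nu> f x = Abs_fps (\<lambda>n. partial \<nu> (\<lambda>y. fps_nth (f y) n) x)"

definition fintegrable :: "(real^3 \<Rightarrow> real fps) \<Rightarrow> bool" where
  "fintegrable f \<longleftrightarrow> (\<forall>n. integrable lborel (\<lambda>x. fps_nth (f x) n))"

definition fint :: "(real^3 \<Rightarrow> real fps) \<Rightarrow> real fps" where
  "fint f = Abs_fps (\<lambda>n. LINT x|lborel. fps_nth (f x) n)"

definition pairing :: "field \<Rightarrow> field \<Rightarrow> real fps" where
  "pairing J A = fint (\<lambda>x. \<Sum>a\<in>UNIV. \<Sum>\<mu>\<in>UNIV. J a \<mu> x * A a \<mu> x)"

definition curvature :: "field \<Rightarrow> 3 \<Rightarrow> 3 \<Rightarrow> 3 \<Rightarrow> real^3 \<Rightarrow> real fps" where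
  "curvature A a \<mu> \<nu> x =
     fpartial \<mu> (A a \<nu>) x - fpartial \<nu> (A a \<mu>) x
     - (\<Sum>b\<in>UNIV. \<Sum>c\<in>UNIV. fps_const (levi_civita a b c) * A b \<mu> x * A c \<nu> x)"

definition cs_density :: "field \<Rightarrow> real^3 \<Rightarrow> real fps" where
  "cs_density A x =
     (\<Sum>\<mu>\<in>UNIV. \<Sum>\<nu>\<in>UNIV. \<Sum>\<kappa>\<in>UNIV. fps_const (levi_civita \<mu> \<nu> \<kappa>) *
        ((\<Sum>a\<in>UNIV. fps_const (1/2) * A a \<mu> x * fpartial \<nu> (A a \<kappa>) x)
         - (\<Sum>a\<in>UNIV. \<Sum>b\<in>UNIV. \<Sum>c\<in>UNIV.
              fps_const (1/6) * fps_const (levi_civita a b c) * A a \<mu> x * A b \<nu> x * A c \<kappa> x)))"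

definition bf_density :: "field \<Rightarrow> field \<Rightarrow> real^3 \<Rightarrow> real fps" where
  "bf_density A B x =
     (\<Sum>\<mu>\<in>UNIV. \<Sum>\<nu>\<in>UNIV. \<Sum>\<kappa>\<in>UNIV. fps_const (levi_civita \<mu> \<nu> \<kappa>) *
        (\<Sum>a\<in>UNIV. fps_const (1/2) * B a \<mu> x * curvature A a \<nu> \<kappa> x))"

definition CS_action :: "field \<Rightarrow> real fps" where
  "CS_action A = fint (cs_density A)"

definition BF_action :: "real \<Rightarrow> field \<Rightarrow> field \<Rightarrow> real fps" where
  "BF_action g A B = fint (bf_density A B) + fps_const g * CS_action A"

definition test_field :: "(3 \<Rightarrow> 3 \<Rightarrow> real^3 \<Rightarrow> real) \<Rightarrow> bool" where
  "test_field \<phi> \<longleftrightarrow> (\<forall>a \<mu>. smooth (\<phi> a \<mu>) \<and> bounded {x. \<phi> a \<mu> x \<noteq> 0})"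

text \<open>
  The variation \<open>s * \<phi>\<close> does not depend on \<open>t\<close>, so that the \<open>n\<close>-th coefficient of the varied
  functional tests the \<open>n\<close>-th coefficient of its functional derivative \<open>E\<close>.
\<close>

definition has_functional_derivative ::
    "(field \<Rightarrow> real fps) \<Rightarrow> field \<Rightarrow> field \<Rightarrow> bool" where
  "has_functional_derivative S A E \<longleftrightarrow>
     (\<forall>\<phi> n. test_field \<phi> \<longrightarrow>
        ((\<lambda>s. fps_nth (S (\<lambda>a \<mu> x. A a \<mu> x + fps_const (s * \<phi> a \<mu> x))) n)
         has_real_derivative fps_nth (pairing E (\<lambda>a \<mu> x. fps_const (\<phi> a \<mu> x))) n) (at 0))"

definition localized_source :: "field \<Rightarrow> bool" where
  "localized_source J \<longleftrightarrow>
     (\<forall>a \<mu>. (\<forall>x. fps_nth (J a \<mu> x) 0 = 0) \<and>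
        (\<forall>n. smooth (\<lambda>x. fps_nth (J a \<mu> x) n) \<and> bounded {x. fps_nth (J a \<mu> x) n \<noteq> 0}))"

definition perturbative_field :: "field \<Rightarrow> bool" where
  "perturbative_field A \<longleftrightarrow>
     (\<forall>a \<mu>. (\<forall>x. fps_nth (A a \<mu> x) 0 = 0) \<and>
        (\<forall>n. smooth (\<lambda>x. fps_nth (A a \<mu> x) n) \<and>
             (\<lambda>x. fps_nth (A a \<mu> x) n) \<in> O[at_infinity](\<lambda>x. 1 / (norm x)\<^sup>2)))"

definition landau_gauge :: "field \<Rightarrow> bool" where
  "landau_gauge A \<longleftrightarrow> (\<forall>a x. (\<Sum>\<mu>\<in>UNIV. fpartial \<mu> (A a \<mu>) x) = 0)"

text \<open>
  The integrability conditions say that the action of the classical fields is a convergent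
  integral; without them the Lebesgue integral in the action would take the value 0 by convention.
\<close>

definition classical_solution :: "real \<Rightarrow> field \<Rightarrow> field \<Rightarrow> field \<Rightarrow> field \<Rightarrow> bool" where
  "classical_solution g J K A B \<longleftrightarrow>
     perturbative_field A \<and> perturbative_field B \<and>
     landau_gauge A \<and> landau_gauge B \<and>
     fintegrable (bf_density A B) \<and> fintegrable (cs_density A) \<and>
     has_functional_derivative (\<lambda>B'. BF_action g A B') B (\<lambda>a \<mu> x. - K a \<mu> x) \<and>
     has_functional_derivative (\<lambda>A'. BF_action g A' B) A (\<lambda>a \<mu> x. - J a \<mu> x)"

definition classical_fields :: "real \<Rightarrow> field \<Rightarrow> field \<Rightarrow> field \<times> field" where
  "classical_fields g J K = (THE (A, B). classical_solution g J K A B)"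

definition W0 :: "real \<Rightarrow> field \<Rightarrow> field \<Rightarrow> real fps" where
  "W0 g J K =
     (case classical_fields g J K of (A, B) \<Rightarrow> BF_action g A B + (pairing J A + pairing K B))"

end

theory Submission
  imports Defs
begin

text \<open>
  Put \<open>E(A) = curl A - 1/2 [A, A]\<close>, where \<open>[A, B]\<close> contracts both fields with the two Levi-Civita
  symbols.  Then the BF Lagrangian is \<open>B \<cdot> E(A)\<close>, and after an integration by parts \<open>E(A)\<close> is also
  the functional derivative of the Chern-Simons action.  Hence the equation of motion of \<open>B\<close>
  is \<open>E(A) = - K\<close>; it makes the BF term cancel against the source term \<open>K \<cdot> B\<close>.  The
  equation of motion of \<open>A\<close> reads \<open>curl B = [A, B] + g K - J\<close>.

  In both equations the brackets contribute to the order \<open>n\<close> in \<open>t\<close> only through lower orders of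
  the fields, because the fields start at order \<open>t\<close>.  So two solutions that agree below order \<open>n\<close>
  differ at order \<open>n\<close> by a field that is curl free and divergence free, hence harmonic, and that
  decays at infinity; the maximum principle shows that it vanishes.
\<close>

section \<open>Smooth functions and test functions\<close>

lemma partial_eqI:
  "(f has_derivative f') (at x) \<Longrightarrow> partial \<nu> f x = f' (axis \<nu> 1)"
  by (simp add: partial_def frechet_derivative_at[symmetric])

lemma smooth_differentiable: "smooth f \<Longrightarrow> f differentiable at x"
  by (metis smooth_def foldr_Nil id_apply)

lemma smooth_partial: "smooth f \<Longrightarrow> smooth (partial \<nu> f)"
proof -
  assume f: "smooth f"
  have "foldr partial \<nu>s (partial \<nu> f) = foldr partial (\<nu>s @ [\<nu>]) f" for \<nu>s
    by simp
  with f show ?thesis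
    unfolding smooth_def by metis
qed

text \<open>Iterated partial derivatives of a member never leave \<open>S\<close>. Exhibiting such a
  set replaces any explicit formula for higher derivatives.\<close>

lemma smooth_coinduct:
  assumes "f \<in> S"
    and "\<And>f x. f \<in> S \<Longrightarrow> f differentiable at x"
    and "\<And>f \<nu>. f \<in> S \<Longrightarrow> partial \<nu> f \<in> S"
  shows "smooth f"
proof -
  have "foldr partial \<nu>s f \<in> S" for \<nu>s
    by (induction \<nu>s) (auto simp: assms)
  then show ?thesis
    using assms(2) by (auto simp: smooth_def)
qed

lemma partial_add:
  assumes "f differentiable at x" "g differentiable at x"
  shows "partial \<nu> (\<lambda>x. f x + g x) x = partial \<nu> f x + partial \<nu> g x"
  using assms unfolding frechet_derivative_works
  by (auto simp: partial_def[of _ f] partial_def[of _ g] intro!: partial_eqI[THEN trans] derivative_eq_intros)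

lemma partial_mult:
  assumes "f differentiable at x" "g differentiable at x"
  shows "partial \<nu> (\<lambda>x. f x * g x) x = partial \<nu> f x * g x + f x * partial \<nu> g x"
  using assms unfolding frechet_derivative_works
  by (subst partial_eqI[OF has_derivative_mult]) (auto simp: partial_def)

lemma partial_const [simp]: "partial \<nu> (\<lambda>x. c) x = 0"
  by (simp add: partial_def)

lemma partial_component: "partial \<nu> (\<lambda>x. x $ i) x = (if i = \<nu> then 1 else 0)"
  by (subst partial_eqI[OF bounded_linear_imp_has_derivative[OF bounded_linear_vec_nth]])
    (auto simp: axis_def)

lemma smooth_const [simp]: "smooth (\<lambda>x. c)"
  by (rule smooth_coinduct[where S = "range (\<lambda>c x. c)"]) (auto simp: fun_eq_iff)

lemma smooth_component: "smooth (\<lambda>x. x $ i)"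
proof (rule smooth_coinduct[where S = "insert (\<lambda>x. x $ i) (range (\<lambda>c x. c))"])
  fix f :: "real^3 \<Rightarrow> real" and x assume "f \<in> insert (\<lambda>x. x $ i) (range (\<lambda>c x. c))"
  then show "f differentiable at x"
    by (auto intro: bounded_linear_imp_differentiable)
next
  fix f :: "real^3 \<Rightarrow> real" and \<nu> assume "f \<in> insert (\<lambda>x. x $ i) (range (\<lambda>c x. c))"
  moreover have "partial \<nu> (\<lambda>x. x $ i) = (\<lambda>x. if i = \<nu> then 1 else 0)"
    by (simp add: fun_eq_iff partial_component)
  moreover have "partial \<nu> (\<lambda>x. c) = (\<lambda>x. 0)" for c
    by (simp add: fun_eq_iff)
  ultimately show "partial \<nu> f \<in> insert (\<lambda>x. x $ i) (range (\<lambda>c x. c))"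
    by auto
qed simp

text \<open>The classical function exp(-1/t) glued to zero. The denominator \<open>t ^ k\<close> is
  carried along because differentiation produces it: the family over all \<open>k\<close> is closed
  under derivatives up to linear combinations.\<close>

definition flat :: "nat \<Rightarrow> real \<Rightarrow> real" where
  "flat k t = (if t \<le> 0 then 0 else exp (- (1 / t)) / t ^ k)"

lemma flat_eq_0_iff: "flat k t = 0 \<longleftrightarrow> t \<le> 0"
  by (simp add: flat_def)

lemma flat_tendsto_0: "(flat k \<longlongrightarrow> 0) (at 0)"
proof -
  have "((\<lambda>t::real. inverse t ^ k / exp (inverse t)) \<longlongrightarrow> 0) (at_right 0)"
    by (rule filterlim_compose[OF tendsto_power_div_exp_0 filterlim_inverse_at_top_right])
  then have "(flat k \<longlongrightarrow> 0) (at_right 0)"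
    by (rule Lim_transform_eventually)
      (auto simp: eventually_at_filter flat_def exp_minus field_simps)
  moreover have "(flat k \<longlongrightarrow> 0) (at_left 0)"
    by (rule tendsto_eventually) (auto simp: eventually_at_filter flat_def)
  ultimately show ?thesis
    by (simp add: filterlim_at_split)
qed

lemma flat_has_real_derivative:
  "(flat k has_real_derivative flat (k + 2) t - real k * flat (k + 1) t) (at t)"
proof -
  consider "t < 0" | "t = 0" | "0 < t" by linarith
  then show ?thesis
  proof cases
    case 1
    have "((\<lambda>x. 0) has_real_derivative 0) (at t)" by simp
    then have "(flat k has_real_derivative 0) (at t)"
      by (rule has_field_derivative_transform_within_open[where S = "{..<0}"])
        (use 1 in \<open>auto simp: flat_def\<close>)
    with 1 show ?thesis by (simp add: flat_def)
  next
    case 2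
    \<comment> \<open>At the origin the difference quotient is again a member of the family, and its
      limit is known.\<close>
    have "flat (k + 1) = (\<lambda>h. (flat k h - flat k 0) / h)"
      by (auto simp: flat_def fun_eq_iff)
    with flat_tendsto_0[of "k + 1"] show ?thesis
      by (simp add: 2 has_field_derivative_iff flat_def[of _ 0])
  next
    case 3
    have "((\<lambda>t. exp (- (1 / t)) / t ^ k) has_real_derivative
        (exp (- (1 / t)) * (1 / t\<^sup>2) * t ^ k - exp (- (1 / t)) * (real k * t ^ (k - 1))) / (t ^ k * t ^ k)) (at t)"
      using 3 by (auto intro!: derivative_eq_intros simp: power2_eq_square)
    also have "(exp (- (1 / t)) * (1 / t\<^sup>2) * t ^ k - exp (- (1 / t)) * (real k * t ^ (k - 1))) / (t ^ k * t ^ k)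
        = flat (k + 2) t - real k * flat (k + 1) t"
      using 3 by (cases k) (simp_all add: flat_def power2_eq_square diff_divide_distrib)
    finally have "((\<lambda>t. exp (- (1 / t)) / t ^ k) has_real_derivative
        flat (k + 2) t - real k * flat (k + 1) t) (at t)" .
    then show ?thesis
      by (rule has_field_derivative_transform_within_open[where S = "{0<..}"])
        (use 3 in \<open>auto simp: flat_def\<close>)
  qed
qed

text \<open>This class is invariant under partial derivatives, which gives all closure properties of
  \<open>smooth\<close> at once by coinduction.\<close>

inductive smooth_alg :: "(real^3 \<Rightarrow> real) \<Rightarrow> bool" where
  base: "smooth f \<Longrightarrow> smooth_alg f"
| flat: "smooth h \<Longrightarrow> smooth_alg (\<lambda>x. flat k (h x))"
| add: "smooth_alg f \<Longrightarrow> smooth_alg g \<Longrightarrow> smooth_alg (\<lambda>x. f x + g x)"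
| mult: "smooth_alg f \<Longrightarrow> smooth_alg g \<Longrightarrow> smooth_alg (\<lambda>x. f x * g x)"

text \<open>Both claims go through one induction because the sum and product rules for
  \<open>partial\<close> need differentiability of the parts. The derivative of
  \<open>flat k (h x)\<close> involves \<open>k + 1\<close> and \<open>k + 2\<close>, so the class
  has to contain all exponents.\<close>

lemma smooth_alg_differentiable_partial:
  assumes "smooth_alg f"
  shows "(\<forall>x. f differentiable at x) \<and> (\<forall>\<nu>. smooth_alg (partial \<nu> f))"
  using assms
proof induction
  case (base f)
  then show ?case
    by (simp add: smooth_differentiable smooth_partial smooth_alg.base)
next
  case (flat h k)
  have h: "(h has_derivative frechet_derivative h (at x)) (at x)" for x
    using smooth_differentiable[OF flat] by (simp add: frechet_derivative_works)
  have d: "((\<lambda>x. flat k (h x)) has_derivative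
      (\<lambda>y. (flat (k + 2) (h x) - real k * flat (k + 1) (h x)) * frechet_derivative h (at x) y)) (at x)"
    for x
    using has_derivative_compose[OF h flat_has_real_derivative[unfolded has_field_derivative_def]]
    by simp
  have "partial \<nu> (\<lambda>x. flat k (h x)) =
      (\<lambda>x. (flat (k + 2) (h x) + (- real k) * flat (k + 1) (h x)) * partial \<nu> h x)" for \<nu>
    by (simp add: partial_eqI[OF d] fun_eq_iff partial_def[of _ h])
  moreover have "smooth_alg (\<lambda>x. (flat (k + 2) (h x) + (- real k) * flat (k + 1) (h x)) * partial \<nu> h x)" for \<nu>
    by (intro smooth_alg.mult smooth_alg.add smooth_alg.flat flat smooth_alg.base
        smooth_const smooth_partial)
  ultimately show ?case
    using d by (auto simp: differentiable_def)
next
  case (add f g)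
  then have "partial \<nu> (\<lambda>x. f x + g x) = (\<lambda>x. partial \<nu> f x + partial \<nu> g x)" for \<nu>
    by (simp add: fun_eq_iff partial_add)
  with add show ?case
    by (auto intro: smooth_alg.add)
next
  case (mult f g)
  then have "partial \<nu> (\<lambda>x. f x * g x) = (\<lambda>x. partial \<nu> f x * g x + f x * partial \<nu> g x)" for \<nu>
    by (simp add: fun_eq_iff partial_mult)
  with mult show ?case
    by (auto intro!: smooth_alg.add smooth_alg.mult)
qed

lemma smooth_alg_imp_smooth: "smooth_alg f \<Longrightarrow> smooth f"
  by (rule smooth_coinduct[where S = "Collect smooth_alg"])
    (auto dest: smooth_alg_differentiable_partial)

section \<open>Closure properties of smooth functions, and bump functions\<close>

lemma smooth_add: "smooth f \<Longrightarrow> smooth g \<Longrightarrow> smooth (\<lambda>x. f x + g x)"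
  and smooth_mult: "smooth f \<Longrightarrow> smooth g \<Longrightarrow> smooth (\<lambda>x. f x * g x)"
  and smooth_flat: "smooth f \<Longrightarrow> smooth (\<lambda>x. flat k (f x))"
  by (auto intro!: smooth_alg_imp_smooth intro: smooth_alg.intros)

lemma smooth_minus: "smooth f \<Longrightarrow> smooth (\<lambda>x. - f x)"
  using smooth_mult[OF smooth_const[of "-1"]] by simp

lemma smooth_diff: "smooth f \<Longrightarrow> smooth g \<Longrightarrow> smooth (\<lambda>x. f x - g x)"
  using smooth_add[OF _ smooth_minus] by simp

lemma smooth_sum: "(\<And>i. i \<in> I \<Longrightarrow> smooth (f i)) \<Longrightarrow> smooth (\<lambda>x. \<Sum>i\<in>I. f i x)"
  by (induction I rule: infinite_finite_induct) (auto intro: smooth_add)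

lemma partial_diff:
  assumes "smooth f" "smooth g"
  shows "partial \<nu> (\<lambda>x. f x - g x) x = partial \<nu> f x - partial \<nu> g x"
  using partial_add[of f x "\<lambda>x. (-1) * g x" \<nu>] partial_mult[of "\<lambda>x. -1" x g \<nu>] assms
  by (simp add: smooth_differentiable smooth_minus)

lemma partial_sum:
  assumes "\<And>i. i \<in> I \<Longrightarrow> smooth (f i)"
  shows "partial \<nu> (\<lambda>x. \<Sum>i\<in>I. f i x) x = (\<Sum>i\<in>I. partial \<nu> (f i) x)"
  using assms
proof (induction I rule: infinite_finite_induct)
  case (insert i I)
  then show ?case
    by (simp add: partial_add smooth_differentiable smooth_sum)
qed auto

lemma smooth_continuous: "smooth f \<Longrightarrow> continuous_on S f"
  by (simp add: continuous_at_imp_continuous_on differentiable_imp_continuous_within smooth_differentiable)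

text \<open>Gives access to one-variable calculus, in particular the mean value theorem, along
  coordinate lines.\<close>

lemma smooth_line_derivative:
  assumes "smooth f"
  shows "((\<lambda>s. f (x + s *\<^sub>R axis \<nu> 1)) has_real_derivative partial \<nu> f (x + s *\<^sub>R axis \<nu> 1)) (at s)"
proof -
  have f: "(f has_derivative frechet_derivative f (at y)) (at y)" for y
    using smooth_differentiable[OF assms] by (simp add: frechet_derivative_works)
  have l: "((\<lambda>s. x + s *\<^sub>R axis \<nu> 1) has_derivative (\<lambda>h. h *\<^sub>R axis \<nu> 1)) (at s)"
    by (auto intro!: derivative_eq_intros)
  have "((\<lambda>s. f (x + s *\<^sub>R axis \<nu> 1)) has_derivative
      (\<lambda>h. frechet_derivative f (at (x + s *\<^sub>R axis \<nu> 1)) (h *\<^sub>R axis \<nu> 1))) (at s)"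
    by (rule has_derivative_compose[OF l f])
  then show ?thesis
    using linear_frechet_derivative[OF smooth_differentiable[OF assms]]
    by (simp add: has_field_derivative_def partial_def linear_cmul mult_commute_abs)
qed

text \<open>The witness composes \<open>flat 0\<close> with the polynomial r^2 - |x - x0|^2, which
  is positive exactly on the ball.\<close>

lemma smooth_bump:
  assumes "0 < r"
  obtains \<beta> where "smooth \<beta>" "\<And>x. 0 \<le> \<beta> x" "\<And>x. \<beta> x \<noteq> 0 \<longleftrightarrow> x \<in> ball x0 r"
proof
  let ?h = "\<lambda>x. r\<^sup>2 - (\<Sum>i\<in>UNIV. (x $ i - x0 $ i) * (x $ i - x0 $ i))"
  have h: "?h x = r\<^sup>2 - (dist x0 x)\<^sup>2" for x
    by (simp add: dist_norm norm_minus_commute[of x0] power2_norm_eq_inner inner_vec_def)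
  show "smooth (\<lambda>x. flat 0 (?h x))"
    by (intro smooth_flat smooth_diff smooth_const smooth_sum smooth_mult smooth_component)
  show "0 \<le> flat 0 (?h x)" for x
    by (simp add: flat_def)
  show "flat 0 (?h x) \<noteq> 0 \<longleftrightarrow> x \<in> ball x0 r" for x
    using power_mono_iff[of r "dist x0 x" 2] assms unfolding h flat_eq_0_iff by auto
qed

section \<open>Decaying harmonic functions\<close>

text \<open>The mean value theorem is used twice: in direction \<open>\<mu>\<close> for the
  increment of \<open>f\<close> along \<open>\<nu>\<close>, then in direction \<open>\<nu>\<close>
  for \<open>partial \<mu> f\<close>. The left side is symmetric in the two directions.\<close>

lemma mixed_difference:
  assumes "smooth f" "0 < h"
  obtains p where "dist p x \<le> 2 * h"
    "f (x + h *\<^sub>R axis \<mu> 1 + h *\<^sub>R axis \<nu> 1) - f (x + h *\<^sub>R axis \<mu> 1) - f (x + h *\<^sub>R axis \<nu> 1) + f x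
      = h\<^sup>2 * partial \<nu> (partial \<mu> f) p"
proof -
  let ?e = "\<lambda>\<nu>. axis \<nu> 1 :: real^3"
  let ?g = "\<lambda>s. f ((x + h *\<^sub>R ?e \<nu>) + s *\<^sub>R ?e \<mu>) - f (x + s *\<^sub>R ?e \<mu>)"
  have "(?g has_real_derivative
      partial \<mu> f ((x + h *\<^sub>R ?e \<nu>) + s *\<^sub>R ?e \<mu>) - partial \<mu> f (x + s *\<^sub>R ?e \<mu>)) (at s)" for s
    by (intro DERIV_diff smooth_line_derivative assms)
  from MVT2[OF assms(2) this] obtain s where s: "0 < s" "s < h"
    and "?g h - ?g 0 = h *
      (partial \<mu> f ((x + h *\<^sub>R ?e \<nu>) + s *\<^sub>R ?e \<mu>) - partial \<mu> f (x + s *\<^sub>R ?e \<mu>))"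
    by auto
  moreover
  from MVT2[OF assms(2) smooth_line_derivative[OF smooth_partial[OF assms(1)]]]
  obtain u where u: "0 < u" "u < h"
    and "partial \<mu> f ((x + s *\<^sub>R ?e \<mu>) + h *\<^sub>R ?e \<nu>) - partial \<mu> f ((x + s *\<^sub>R ?e \<mu>) + 0 *\<^sub>R ?e \<nu>)
      = (h - 0) * partial \<nu> (partial \<mu> f) ((x + s *\<^sub>R ?e \<mu>) + u *\<^sub>R ?e \<nu>)"
    by metis
  ultimately have "?g h - ?g 0 = h * (h * partial \<nu> (partial \<mu> f) (x + s *\<^sub>R ?e \<mu> + u *\<^sub>R ?e \<nu>))"
    by (simp add: add_ac)
  moreover have "dist (x + s *\<^sub>R ?e \<mu> + u *\<^sub>R ?e \<nu>) x \<le> 2 * h"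
    using s u norm_triangle_ineq[of "s *\<^sub>R ?e \<mu>" "u *\<^sub>R ?e \<nu>"] by (simp add: dist_norm)
  ultimately show thesis
    by (intro that[of "x + s *\<^sub>R ?e \<mu> + u *\<^sub>R ?e \<nu>"]) (auto simp: power2_eq_square algebra_simps)
qed

text \<open>By the symmetry of the second difference, both mixed derivatives attain a common value
  at points arbitrarily near \<open>x\<close>; continuity does the rest.\<close>

lemma partial_commute:
  assumes "smooth f"
  shows "partial \<mu> (partial \<nu> f) x = partial \<nu> (partial \<mu> f) x"
proof (rule ccontr)
  let ?F = "partial \<mu> (partial \<nu> f)" and ?G = "partial \<nu> (partial \<mu> f)"
  assume neq: "?F x \<noteq> ?G x"
  \<comment> \<open>Half the gap: a common value cannot lie within \<open>e\<close> of both
    derivatives at \<open>x\<close>.\<close>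
  define e where "e = \<bar>?F x - ?G x\<bar> / 2"
  have "e > 0" using neq by (simp add: e_def)
  have "continuous (at x) ?F" "continuous (at x) ?G"
    using assms by (auto intro!: differentiable_imp_continuous_within smooth_differentiable smooth_partial)
  then obtain d1 d2 where d: "d1 > 0" "d2 > 0"
    and F: "\<And>y. dist y x < d1 \<Longrightarrow> dist (?F y) (?F x) < e"
    and G: "\<And>y. dist y x < d2 \<Longrightarrow> dist (?G y) (?G x) < e"
    using \<open>e > 0\<close> unfolding continuous_at_eps_delta by metis
  \<comment> \<open>The quarter keeps the intermediate points, at distance up to
    \<open>2 * h\<close>, inside both continuity radii.\<close>
  define h where "h = min d1 d2 / 4"
  have h: "h > 0" "2 * h < d1" "2 * h < d2" using d by (auto simp: h_def min_def)
  obtain p where "dist p x \<le> 2 * h"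
    and p: "f (x + h *\<^sub>R axis \<mu> 1 + h *\<^sub>R axis \<nu> 1) - f (x + h *\<^sub>R axis \<mu> 1) - f (x + h *\<^sub>R axis \<nu> 1) + f x
      = h\<^sup>2 * ?G p"
    using mixed_difference[OF assms h(1)] by metis
  obtain q where "dist q x \<le> 2 * h"
    and q: "f (x + h *\<^sub>R axis \<nu> 1 + h *\<^sub>R axis \<mu> 1) - f (x + h *\<^sub>R axis \<nu> 1) - f (x + h *\<^sub>R axis \<mu> 1) + f x
      = h\<^sup>2 * ?F q"
    using mixed_difference[OF assms h(1)] by metis
  have "h\<^sup>2 * ?G p = h\<^sup>2 * ?F q"
    using p q by (simp add: algebra_simps)
  then have "?G p = ?F q" using h(1) by simp
  moreover have "dist (?F q) (?F x) < e" "dist (?G p) (?G x) < e"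
    using F[of q] G[of p] h \<open>dist p x \<le> 2 * h\<close> \<open>dist q x \<le> 2 * h\<close> by auto
  ultimately show False
    by (auto simp: e_def dist_real_def abs_if split: if_splits)
qed

section \<open>Maximum principle\<close>

text \<open>If \<open>l\<close> were positive, \<open>g'\<close> would be positive just to the right
  of its zero at 0, and \<open>g\<close> would exceed its maximum there.\<close>

lemma second_derivative_local_max:
  fixes g :: "real \<Rightarrow> real"
  assumes g': "\<And>s. (g has_real_derivative g' s) (at s)"
    and g'': "(g' has_real_derivative l) (at 0)"
    and "d > 0" and max: "\<And>s. \<bar>s\<bar> < d \<Longrightarrow> g s \<le> g 0"
  shows "l \<le> 0"
proof (rule ccontr)
  assume "\<not> l \<le> 0"
  then obtain e where e: "e > 0" "\<And>h. 0 < h \<Longrightarrow> h < e \<Longrightarrow> g' 0 < g' h"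
    using DERIV_pos_inc_right[OF g''] by auto
  have "g' 0 = 0"
    by (rule DERIV_local_max[OF g' \<open>d > 0\<close>]) (use max in auto)
  define h where "h = min d e / 2"
  have h: "0 < h" "h < d" "h < e" using \<open>d > 0\<close> \<open>e > 0\<close> by (auto simp: h_def min_def)
  obtain z where "0 < z" "z < h" "g h - g 0 = (h - 0) * g' z"
    using MVT2[OF h(1) g'] by metis
  moreover from this have "g' z > 0" using e(2)[of z] h \<open>g' 0 = 0\<close> by simp
  ultimately have "g h > g 0" using h by (metis diff_gt_0_iff_gt diff_zero mult_pos_pos)
  with max[of h] h show False by simp
qed

text \<open>Perturbing a harmonic function by a small multiple of \<open>|x|\<^sup>2\<close> makes its Laplacian positive,
  which excludes an interior maximum.\<close>

lemma harmonic_decaying_nonpos: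
  assumes u: "smooth u" and harm: "\<And>x. (\<Sum>\<nu>\<in>UNIV. partial \<nu> (partial \<nu> u) x) = 0"
    and lim: "(u \<longlongrightarrow> 0) at_infinity"
  shows "u x \<le> 0"
proof (rule ccontr)
  assume "\<not> u x \<le> 0"
  then have ux: "u x / 2 > 0" by simp
  from tendstoD[OF lim this] obtain b where b: "\<And>y. norm y \<ge> b \<Longrightarrow> \<bar>u y\<bar> < u x / 2"
    by (auto simp: eventually_at_infinity dist_real_def)
  \<comment> \<open>On the sphere of radius \<open>R\<close> the function stays below
    \<open>u x / 2\<close>, the ball contains \<open>x\<close>, and the bound 1 keeps
    \<open>R\<close> nonzero.\<close>
  define R where "R = max (max b (norm x)) 1"
  have R: "R \<ge> b" "R \<ge> norm x" "R \<ge> 1" by (auto simp: R_def)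
  \<comment> \<open>The quadratic term is worth \<open>u x / 4\<close> on the sphere, so
    \<open>v\<close> stays below 3/4 of \<open>u x\<close> there and its maximum is
    interior.\<close>
  define \<epsilon> where "\<epsilon> = u x / (4 * R\<^sup>2)"
  have \<epsilon>: "\<epsilon> > 0" "\<epsilon> * R\<^sup>2 = u x / 4" using R ux by (auto simp: \<epsilon>_def)
  define v where "v = (\<lambda>y. u y + \<epsilon> * (norm y)\<^sup>2)"
  have "continuous_on (cball 0 R) v"
    unfolding v_def by (intro continuous_intros smooth_continuous u)
  then obtain y where y: "y \<in> cball 0 R" "\<And>z. z \<in> cball 0 R \<Longrightarrow> v z \<le> v y"
    using continuous_attains_sup[of "cball 0 R" v] R by auto
  have "v x \<ge> u x" using \<epsilon> by (simp add: v_def)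
  moreover have "v x \<le> v y" using y R by simp
  moreover have "v y < u x" if "norm y = R"
    using b[of y] that R \<epsilon> ux by (auto simp: v_def)
  ultimately have "norm y < R" using y(1) by fastforce
  have "partial \<nu> (partial \<nu> u) y + 2 * \<epsilon> \<le> 0" for \<nu>
  proof (rule second_derivative_local_max)
    let ?e = "axis \<nu> 1 :: real^3"
    have sq: "(norm (y + s *\<^sub>R ?e))\<^sup>2 = (norm y)\<^sup>2 + 2 * s * y $ \<nu> + s\<^sup>2" for s
      unfolding power2_norm_eq_inner
      by (simp add: inner_axis inner_axis_axis algebra_simps inner_commute power2_eq_square)
    show "((\<lambda>s. v (y + s *\<^sub>R ?e)) has_real_derivative
        partial \<nu> u (y + s *\<^sub>R ?e) + \<epsilon> * (2 * y $ \<nu> + 2 * s)) (at s)" for s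
      unfolding v_def sq by (auto intro!: derivative_eq_intros smooth_line_derivative u)
    show "((\<lambda>s. partial \<nu> u (y + s *\<^sub>R ?e) + \<epsilon> * (2 * y $ \<nu> + 2 * s)) has_real_derivative
        partial \<nu> (partial \<nu> u) y + 2 * \<epsilon>) (at 0)"
      using smooth_line_derivative[OF smooth_partial[OF u], of \<nu> y \<nu> 0]
      by (auto intro!: derivative_eq_intros)
    show "0 < R - norm y" using \<open>norm y < R\<close> by simp
    show "v (y + s *\<^sub>R ?e) \<le> v (y + 0 *\<^sub>R ?e)" if "\<bar>s\<bar> < R - norm y" for s
      using y(2)[of "y + s *\<^sub>R ?e"] that norm_triangle_ineq[of y "s *\<^sub>R ?e"] by simp
  qed
  \<comment> \<open>By harmonicity only the three contributions \<open>2 * \<epsilon>\<close>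
    survive, which are positive.\<close>
  then have "(\<Sum>\<nu>\<in>UNIV. partial \<nu> (partial \<nu> u) y + 2 * \<epsilon>) \<le> 0"
    by (rule sum_nonpos)
  then show False using harm[of y] \<epsilon> by (simp add: sum.distrib)
qed

lemma harmonic_decaying_eq_0:
  assumes u: "smooth u" and harm: "\<And>x. (\<Sum>\<nu>\<in>UNIV. partial \<nu> (partial \<nu> u) x) = 0"
    and lim: "(u \<longlongrightarrow> 0) at_infinity"
  shows "u x = 0"
proof -
  have m: "partial \<nu> (\<lambda>x. - f x) = (\<lambda>x. - partial \<nu> f x)" if "smooth f" for f \<nu>
    using partial_diff[of "\<lambda>x. 0" f \<nu>] that by auto
  have "- u x \<le> 0"
    by (rule harmonic_decaying_nonpos[of "\<lambda>x. - u x"])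
      (use assms tendsto_minus[OF lim] in \<open>auto simp: m smooth_partial sum_negf intro: smooth_minus\<close>)
  with harmonic_decaying_nonpos[OF assms, of x] show ?thesis by simp
qed

text \<open>Commuting derivatives turn the Laplacian of each component into a derivative of the
  divergence, so each component is harmonic and decays.\<close>

lemma curl_free_divergence_free_eq_0:
  fixes d :: "3 \<Rightarrow> real^3 \<Rightarrow> real"
  assumes d: "\<And>\<mu>. smooth (d \<mu>)"
    and curl: "\<And>\<mu> \<nu> x. partial \<nu> (d \<mu>) x = partial \<mu> (d \<nu>) x"
    and div: "\<And>x. (\<Sum>\<mu>\<in>UNIV. partial \<mu> (d \<mu>) x) = 0"
    and lim: "\<And>\<mu>. (d \<mu> \<longlongrightarrow> 0) at_infinity"
  shows "d \<mu> x = 0"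
proof (rule harmonic_decaying_eq_0[OF d _ lim])
  fix x
  have "partial \<nu> (partial \<nu> (d \<mu>)) x = partial \<mu> (partial \<nu> (d \<nu>)) x" for \<nu>
    using curl partial_commute[OF d] by (metis ext)
  then have "(\<Sum>\<nu>\<in>UNIV. partial \<nu> (partial \<nu> (d \<mu>)) x) = partial \<mu> (\<lambda>x. \<Sum>\<nu>\<in>UNIV. partial \<nu> (d \<nu>) x) x"
    by (simp add: partial_sum smooth_partial d)
  also have "\<dots> = 0" by (simp add: div)
  finally show "(\<Sum>\<nu>\<in>UNIV. partial \<nu> (partial \<nu> (d \<mu>)) x) = 0" .
qed

section \<open>Integration against test functions\<close>

lemma continuous_bounded_support_integrable:
  fixes f :: "'a::euclidean_space \<Rightarrow> real"
  assumes "continuous_on UNIV f" "bounded {x. f x \<noteq> 0}"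
  shows "integrable lborel f"
proof -
  let ?K = "closure {x. f x \<noteq> 0}"
  have "integrable lborel (\<lambda>x. indicator ?K x *\<^sub>R f x)"
    using assms by (intro borel_integrable_compact) (auto intro: continuous_on_subset)
  moreover have "(\<lambda>x. indicator ?K x *\<^sub>R f x) = f"
    using closure_subset[of "{x. f x \<noteq> 0}"] by (auto simp: fun_eq_iff indicator_def)
  ultimately show ?thesis by simp
qed

lemma continuous_bounded_support_bounded:
  fixes f :: "'a::euclidean_space \<Rightarrow> real"
  assumes "continuous_on UNIV f" "bounded {x. f x \<noteq> 0}"
  obtains C where "0 < C" "\<And>x. \<bar>f x\<bar> \<le> C"
proof -
  let ?K = "closure {x. f x \<noteq> 0}"
  have "compact (f ` ?K)"
    using assms by (intro compact_continuous_image) (auto intro: continuous_on_subset)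
  then obtain C where C: "C > 0" "\<And>x. x \<in> ?K \<Longrightarrow> \<bar>f x\<bar> \<le> C"
    using compact_imp_bounded bounded_pos by (metis imageI real_norm_def)
  have "\<bar>f x\<bar> \<le> C" for x
    using C closure_subset[of "{x. f x \<noteq> 0}"] by (cases "f x = 0") auto
  with C(1) that show thesis by blast
qed

text \<open>The set where \<open>f\<close> is nonzero is open, and the vanishing integral makes it
  null; a nonempty open set is not null.\<close>

lemma continuous_nonneg_integral_eq_0:
  fixes f :: "'a::euclidean_space \<Rightarrow> real"
  assumes f: "continuous_on UNIV f" "integrable lborel f" "\<And>x. 0 \<le> f x"
    and zero: "(LINT x|lborel. f x) = 0"
  shows "f x = 0"
proof (rule ccontr)
  assume "f x \<noteq> 0"
  have "AE x in lborel. f x = 0"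
    using integral_nonneg_eq_0_iff_AE[OF f(2)] f(3) zero by simp
  moreover have "open {x. f x \<noteq> 0}"
    by (rule open_Collect_neq) (auto intro: f continuous_on_const)
  ultimately have "{x. f x \<noteq> 0} \<in> null_sets lborel"
    by (subst AE_iff_null_sets) auto
  then have "negligible {x. f x \<noteq> 0}"
    by (simp add: negligible_iff_null_sets null_sets_completionI)
  with \<open>open {x. f x \<noteq> 0}\<close> open_not_negligible \<open>f x \<noteq> 0\<close> show False
    by blast
qed

lemma bounded_support_partial:
  assumes "bounded {x. f x \<noteq> 0}"
  shows "bounded {x. partial \<nu> f x \<noteq> 0}"
proof (rule bounded_subset)
  show "bounded (closure {x. f x \<noteq> 0})" using assms by (rule bounded_closure)
  show "{x. partial \<nu> f x \<noteq> 0} \<subseteq> closure {x. f x \<noteq> 0}"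
  proof (clarify, rule ccontr)
    fix x assume ne: "partial \<nu> f x \<noteq> 0" and x: "x \<notin> closure {x. f x \<noteq> 0}"
    have "(f has_derivative (\<lambda>_. 0)) (at x)"
      by (rule has_derivative_transform_within_open
          [where f = "\<lambda>_. 0" and s = "- closure {x. f x \<noteq> 0}"])
        (use x closure_subset[of "{x. f x \<noteq> 0}"] in auto)
    then have "partial \<nu> f x = 0" by (simp add: partial_eqI)
    with ne show False by simp
  qed
qed

lemma integral_translate:
  fixes f :: "'a::euclidean_space \<Rightarrow> real"
  assumes "f \<in> borel_measurable borel"
  shows "(LINT x|lborel. f (x + c)) = (LINT x|lborel. f x)"
proof -
  have "(LINT x|lborel. f x) = (LINT x|distr lborel borel ((+) c). f x)"
    by (simp add: lborel_distr_plus)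
  also have "\<dots> = (LINT x|lborel. f (c + x))"
    by (rule integral_distr) (use assms in auto)
  finally show ?thesis by (simp add: add.commute)
qed

text \<open>Difference quotients of \<open>f\<close> have integral 0 because the integral is translation invariant.\<close>

lemma integral_partial_eq_0:
  assumes f: "smooth f" and supp: "bounded {x. f x \<noteq> 0}"
  shows "(LINT x|lborel. partial \<nu> f x) = 0"
proof -
  let ?e = "axis \<nu> 1 :: real^3"
  define h where "h n = inverse (real (Suc n))" for n
  have h: "0 < h n" "h n \<le> 1" "h \<longlonglongrightarrow> 0" for n
    using LIMSEQ_inverse_real_of_nat by (auto simp: h_def[abs_def] field_simps)
  define s where "s n x = (f (x + h n *\<^sub>R ?e) - f x) / h n" for n x
  obtain C where C: "0 < C" "\<And>x. \<bar>partial \<nu> f x\<bar> \<le> C"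
    using continuous_bounded_support_bounded[of "partial \<nu> f"] bounded_support_partial[OF supp]
      smooth_continuous[OF smooth_partial[OF f]] by metis
  obtain R where R: "\<And>x. f x \<noteq> 0 \<Longrightarrow> norm x \<le> R"
    using supp by (auto simp: bounded_iff)
  have meas: "f \<in> borel_measurable borel" "partial \<nu> f \<in> borel_measurable borel"
    using f by (auto intro!: borel_measurable_continuous_onI smooth_continuous smooth_partial)
  have int: "integrable lborel (\<lambda>x. f (x + c))" for c
  proof (rule continuous_bounded_support_integrable)
    show "continuous_on UNIV (\<lambda>x. f (x + c))"
      by (intro continuous_on_compose2[OF smooth_continuous[OF f]] continuous_intros) auto
    have "{x. f (x + c) \<noteq> 0} = (+) (- c) ` {x. f x \<noteq> 0}"
      by (auto simp: image_iff intro!: exI[of _ "_ + c"])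
    then show "bounded {x. f (x + c) \<noteq> 0}"
      using supp by (simp add: bounded_translation_minus)
  qed
  have "(\<lambda>n. LINT x|lborel. s n x) \<longlonglongrightarrow> (LINT x|lborel. partial \<nu> f x)"
  proof (rule integral_dominated_convergence)
    \<comment> \<open>Steps are at most 1, so the quotients vanish outside the ball of radius
      \<open>R + 1\<close>; inside, the mean value theorem bounds them by \<open>C\<close>.\<close>
    let ?w = "\<lambda>x. indicator (cball (0::real^3) (R + 1)) x *\<^sub>R C"
    show "integrable lborel ?w"
      by (intro borel_integrable_compact) auto
    show "AE x in lborel. (\<lambda>n. s n x) \<longlonglongrightarrow> partial \<nu> f x"
    proof (rule AE_I2)
      fix x
      have "((\<lambda>k. (f (x + k *\<^sub>R ?e) - f x) / k) \<longlongrightarrow> partial \<nu> f x) (at 0)"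
        using smooth_line_derivative[OF f, of x \<nu> 0] by (simp add: has_field_derivative_iff)
      moreover have "filterlim h (at 0) sequentially"
        using h by (auto simp: filterlim_at intro!: always_eventually) (metis less_irrefl)
      ultimately show "(\<lambda>n. s n x) \<longlonglongrightarrow> partial \<nu> f x"
        unfolding s_def by (rule filterlim_compose)
    qed
    show "AE x in lborel. norm (s n x) \<le> ?w x" for n
    proof (rule AE_I2)
      fix x
      show "norm (s n x) \<le> ?w x"
      proof (cases "norm x \<le> R + 1")
        case True
        obtain z where "f (x + h n *\<^sub>R ?e) - f (x + 0 *\<^sub>R ?e)
            = (h n - 0) * partial \<nu> f (x + z *\<^sub>R ?e)"
          using MVT2[OF h(1) smooth_line_derivative[OF f]] by metis
        then have "s n x = partial \<nu> f (x + z *\<^sub>R ?e)"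
          using h(1)[of n] by (simp add: s_def)
        with C True show ?thesis by simp
      next
        case False
        have "norm (x + h n *\<^sub>R ?e) \<ge> norm x - norm (h n *\<^sub>R ?e)"
          by (rule norm_diff_ineq)
        moreover have "norm (h n *\<^sub>R ?e) \<le> 1"
          using h(1,2)[of n] by simp
        ultimately have "f (x + h n *\<^sub>R ?e) = 0" "f x = 0"
          using R[of x] R[of "x + h n *\<^sub>R ?e"] False by auto
        with C(1) show ?thesis by (simp add: s_def)
      qed
    qed
  qed (use meas in \<open>auto simp: s_def\<close>)
  moreover have "(LINT x|lborel. s n x) = 0" for n
    using int[of "h n *\<^sub>R ?e"] int[of 0] integral_translate[OF meas(1)]
    by (simp add: s_def)
  ultimately show ?thesis
    by (simp add: LIMSEQ_const_iff)
qed

text \<open>The fundamental lemma of the calculus of variations. A bump on a ball where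
  \<open>E\<close> keeps its sign gives, up to that sign, a nonnegative integrand with integral zero
  that does not vanish at \<open>x0\<close>.\<close>

lemma fundamental_lemma:
  assumes E: "continuous_on UNIV E"
    and zero: "\<And>\<beta>. smooth \<beta> \<Longrightarrow> bounded {x. \<beta> x \<noteq> 0} \<Longrightarrow> (LINT x|lborel. E x * \<beta> x) = 0"
  shows "E x0 = 0"
proof (rule ccontr)
  assume "E x0 \<noteq> 0"
  define \<sigma> where "\<sigma> = sgn (E x0)"
  have "open {x. 0 < \<sigma> * E x}"
    by (intro open_Collect_less continuous_intros E)
  moreover have "0 < \<sigma> * E x0"
    using \<open>E x0 \<noteq> 0\<close> by (simp add: \<sigma>_def sgn_real_def)
  ultimately obtain r where "r > 0" "ball x0 r \<subseteq> {x. 0 < \<sigma> * E x}"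
    using openE by blast
  then have r: "r > 0" "\<And>x. x \<in> ball x0 r \<Longrightarrow> 0 < \<sigma> * E x"
    by auto
  obtain \<beta> where \<beta>: "smooth \<beta>" "\<And>x. 0 \<le> \<beta> x" "\<And>x. \<beta> x \<noteq> 0 \<longleftrightarrow> x \<in> ball x0 r"
    using smooth_bump[OF r(1), of x0] by metis
  have supp: "bounded {x. \<beta> x \<noteq> 0}"
    using bounded_ball[of x0 r] by (simp add: \<beta>(3) del: mem_ball)
  have "\<sigma> * E x0 * \<beta> x0 = 0"
  proof (rule continuous_nonneg_integral_eq_0[where f = "\<lambda>x. \<sigma> * E x * \<beta> x"])
    show cont: "continuous_on UNIV (\<lambda>x. \<sigma> * E x * \<beta> x)"
      by (intro continuous_intros E smooth_continuous \<beta>)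
    show "integrable lborel (\<lambda>x. \<sigma> * E x * \<beta> x)"
      by (rule continuous_bounded_support_integrable[OF cont bounded_subset[OF supp]]) auto
    show "0 \<le> \<sigma> * E x * \<beta> x" for x
      using r(2)[of x] \<beta>(2)[of x] \<beta>(3)[of x] by (cases "\<beta> x = 0") (auto intro: less_imp_le)
    show "(LINT x|lborel. \<sigma> * E x * \<beta> x) = 0"
      using zero[OF \<beta>(1) supp] by (simp add: mult.assoc)
  qed
  with \<open>0 < \<sigma> * E x0\<close> \<beta>(3)[of x0] r(1) show False by auto
qed

section \<open>Power series valued fields\<close>

definition fsmooth :: "(real^3 \<Rightarrow> real fps) \<Rightarrow> bool" where
  "fsmooth f \<longleftrightarrow> (\<forall>n. smooth (\<lambda>x. fps_nth (f x) n))"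

text \<open>The bound on the support may depend on the order \<open>n\<close>. This is enough, since
  derivatives and integrals act order by order and products mix finitely many orders.\<close>

definition ftest :: "(real^3 \<Rightarrow> real fps) \<Rightarrow> bool" where
  "ftest f \<longleftrightarrow> fsmooth f \<and> (\<forall>n. bounded {x. fps_nth (f x) n \<noteq> 0})"

section \<open>Calculus of power series valued functions, order by order\<close>

lemma fpartial_nth: "fps_nth (fpartial \<nu> f x) n = partial \<nu> (\<lambda>y. fps_nth (f y) n) x"
  by (simp add: fpartial_def)

lemma fint_nth: "fps_nth (fint f) n = (LINT x|lborel. fps_nth (f x) n)"
  by (simp add: fint_def)

lemma fsmooth_add: "fsmooth f \<Longrightarrow> fsmooth g \<Longrightarrow> fsmooth (\<lambda>x. f x + g x)"
  and fsmooth_diff: "fsmooth f \<Longrightarrow> fsmooth g \<Longrightarrow> fsmooth (\<lambda>x. f x - g x)"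
  and fsmooth_uminus: "fsmooth f \<Longrightarrow> fsmooth (\<lambda>x. - f x)"
  and fsmooth_mult: "fsmooth f \<Longrightarrow> fsmooth g \<Longrightarrow> fsmooth (\<lambda>x. f x * g x)"
  and fsmooth_const: "fsmooth (\<lambda>x. c)"
  and fsmooth_fpartial: "fsmooth f \<Longrightarrow> fsmooth (fpartial \<nu> f)"
  by (auto simp: fsmooth_def fps_mult_nth fpartial_nth intro!: smooth_add smooth_diff smooth_minus
      smooth_sum smooth_mult smooth_partial)

lemma fsmooth_sum: "(\<And>i. i \<in> I \<Longrightarrow> fsmooth (f i)) \<Longrightarrow> fsmooth (\<lambda>x. \<Sum>i\<in>I. f i x)"
  by (auto simp: fsmooth_def fps_sum_nth intro!: smooth_sum)

lemmas fsmooth_intros =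
  fsmooth_add fsmooth_diff fsmooth_uminus fsmooth_mult fsmooth_const fsmooth_fpartial fsmooth_sum

lemma ftest_imp_fsmooth: "ftest f \<Longrightarrow> fsmooth f"
  by (simp add: ftest_def)

lemma ftest_add: "ftest f \<Longrightarrow> ftest g \<Longrightarrow> ftest (\<lambda>x. f x + g x)"
  unfolding ftest_def
proof (intro conjI allI)
  fix n assume *: "fsmooth f \<and> (\<forall>n. bounded {x. fps_nth (f x) n \<noteq> 0})"
    "fsmooth g \<and> (\<forall>n. bounded {x. fps_nth (g x) n \<noteq> 0})"
  then show "fsmooth (\<lambda>x. f x + g x)" by (simp add: fsmooth_add)
  have "bounded ({x. fps_nth (f x) n \<noteq> 0} \<union> {x. fps_nth (g x) n \<noteq> 0})"
    using * by simp
  then show "bounded {x. fps_nth (f x + g x) n \<noteq> 0}"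
    by (rule bounded_subset) auto
qed

text \<open>A coefficient of the product involves finitely many coefficients of \<open>f\<close>, so
  its support lies in a finite union of bounded sets.\<close>

lemma ftest_mult_left:
  assumes "ftest f" "fsmooth g"
  shows "ftest (\<lambda>x. f x * g x)"
  unfolding ftest_def
proof (intro conjI allI)
  show "fsmooth (\<lambda>x. f x * g x)"
    using assms by (simp add: ftest_def fsmooth_mult)
  show "bounded {x. fps_nth (f x * g x) n \<noteq> 0}" for n
  proof (rule bounded_subset)
    show "bounded (\<Union>i\<in>{0..n}. {x. fps_nth (f x) i \<noteq> 0})"
      using assms by (auto simp: ftest_def)
    show "{x. fps_nth (f x * g x) n \<noteq> 0} \<subseteq> (\<Union>i\<in>{0..n}. {x. fps_nth (f x) i \<noteq> 0})"
    proof clarify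
      fix x assume "fps_nth (f x * g x) n \<noteq> 0"
      then obtain i where "i \<in> {0..n}" "fps_nth (f x) i * fps_nth (g x) (n - i) \<noteq> 0"
        unfolding fps_mult_nth by (metis (no_types, lifting) sum.neutral)
      then show "x \<in> (\<Union>i\<in>{0..n}. {x. fps_nth (f x) i \<noteq> 0})" by auto
    qed
  qed
qed

lemma ftest_mult_right: "fsmooth f \<Longrightarrow> ftest g \<Longrightarrow> ftest (\<lambda>x. f x * g x)"
  using ftest_mult_left[of g f] by (simp add: mult.commute)

lemma ftest_sum: "(\<And>i. i \<in> I \<Longrightarrow> ftest (f i)) \<Longrightarrow> ftest (\<lambda>x. \<Sum>i\<in>I. f i x)"
  by (induction I rule: infinite_finite_induct) (auto intro: ftest_add simp: ftest_def[of "\<lambda>x. 0"] fsmooth_const)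

lemma ftest_diff: "ftest f \<Longrightarrow> ftest g \<Longrightarrow> ftest (\<lambda>x. f x - g x)"
  using ftest_add[of f "\<lambda>x. (-1) * g x"] ftest_mult_right[OF fsmooth_const, of g "-1"] by simp

lemma ftest_fpartial: "ftest f \<Longrightarrow> ftest (fpartial \<nu> f)"
  by (auto simp: ftest_def fsmooth_fpartial fpartial_nth intro!: bounded_support_partial)

lemma ftest_fintegrable: "ftest f \<Longrightarrow> fintegrable f"
  by (auto simp: ftest_def fsmooth_def fintegrable_def
      intro!: continuous_bounded_support_integrable smooth_continuous)

lemma fint_fpartial_eq_0: "ftest f \<Longrightarrow> fint (fpartial \<nu> f) = 0"
  by (simp add: fps_eq_iff fint_nth fpartial_nth integral_partial_eq_0 ftest_def fsmooth_def)

lemma fpartial_add: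
  "fsmooth f \<Longrightarrow> fsmooth g \<Longrightarrow> fpartial \<nu> (\<lambda>x. f x + g x) x = fpartial \<nu> f x + fpartial \<nu> g x"
  by (simp add: fps_eq_iff fpartial_nth partial_add fsmooth_def smooth_differentiable)

lemma fpartial_const: "fpartial \<nu> (\<lambda>x. c) x = 0"
  by (simp add: fps_eq_iff fpartial_nth)

lemma fpartial_mult:
  assumes "fsmooth f" "fsmooth g"
  shows "fpartial \<nu> (\<lambda>x. f x * g x) x = fpartial \<nu> f x * g x + f x * fpartial \<nu> g x"
  using assms
  by (simp add: fps_eq_iff fpartial_nth fps_mult_nth fsmooth_def partial_sum smooth_mult partial_mult
      smooth_differentiable sum.distrib)

lemma fpartial_cmult: "fsmooth f \<Longrightarrow> fpartial \<nu> (\<lambda>x. c * f x) x = c * fpartial \<nu> f x"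
  by (simp add: fpartial_mult fsmooth_const fpartial_const)

lemma fpartial_sum:
  "(\<And>i. i \<in> I \<Longrightarrow> fsmooth (f i)) \<Longrightarrow> fpartial \<nu> (\<lambda>x. \<Sum>i\<in>I. f i x) x = (\<Sum>i\<in>I. fpartial \<nu> (f i) x)"
  by (simp add: fps_eq_iff fpartial_nth fps_sum_nth fsmooth_def partial_sum)

lemma fint_add: "fintegrable f \<Longrightarrow> fintegrable g \<Longrightarrow> fint (\<lambda>x. f x + g x) = fint f + fint g"
  by (simp add: fps_eq_iff fint_nth fintegrable_def)

lemma fint_diff: "fintegrable f \<Longrightarrow> fintegrable g \<Longrightarrow> fint (\<lambda>x. f x - g x) = fint f - fint g"
  by (simp add: fps_eq_iff fint_nth fintegrable_def)

lemma fint_cmult: "fint (\<lambda>x. fps_const c * f x) = fps_const c * fint f"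
  by (simp add: fps_eq_iff fint_nth)

lemma fint_uminus: "fint (\<lambda>x. - f x) = - fint f"
  by (simp add: fps_eq_iff fint_nth)

lemma fintegrable_add: "fintegrable f \<Longrightarrow> fintegrable g \<Longrightarrow> fintegrable (\<lambda>x. f x + g x)"
  by (simp add: fintegrable_def)

lemma fintegrable_diff: "fintegrable f \<Longrightarrow> fintegrable g \<Longrightarrow> fintegrable (\<lambda>x. f x - g x)"
  by (simp add: fintegrable_def)

lemma fintegrable_cmult: "fintegrable f \<Longrightarrow> fintegrable (\<lambda>x. fps_const c * f x)"
  by (simp add: fintegrable_def)

section \<open>Algebra of the dot product, curl and bracket of fields\<close>

lemma levi_civita_swap:
  "levi_civita b a c = - levi_civita a b c" "levi_civita a c b = - levi_civita a b c"
proof -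
  have "\<forall>a b c. levi_civita b a c = - levi_civita a b c \<and> levi_civita a c b = - levi_civita a b c"
    unfolding forall_3 by (simp add: levi_civita_def)
  then show "levi_civita b a c = - levi_civita a b c" "levi_civita a c b = - levi_civita a b c"
    by blast+
qed

definition field_dot :: "field \<Rightarrow> field \<Rightarrow> real^3 \<Rightarrow> real fps" where
  "field_dot A E x = (\<Sum>a\<in>UNIV. \<Sum>\<mu>\<in>UNIV. A a \<mu> x * E a \<mu> x)"

definition field_curl :: "field \<Rightarrow> field" where
  "field_curl A a \<mu> x =
     (\<Sum>\<nu>\<in>UNIV. \<Sum>\<kappa>\<in>UNIV. fps_const (levi_civita \<mu> \<nu> \<kappa>) * fpartial \<nu> (A a \<kappa>) x)"

definition field_bracket :: "field \<Rightarrow> field \<Rightarrow> field" where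
  "field_bracket A B a \<mu> x =
     (\<Sum>\<nu>\<in>UNIV. \<Sum>\<kappa>\<in>UNIV. \<Sum>b\<in>UNIV. \<Sum>c\<in>UNIV.
        fps_const (levi_civita \<mu> \<nu> \<kappa>) * fps_const (levi_civita a b c) * (A b \<nu> x * B c \<kappa> x))"

definition field_smooth :: "field \<Rightarrow> bool" where
  "field_smooth A \<longleftrightarrow> (\<forall>a \<mu>. fsmooth (A a \<mu>))"

definition field_test :: "field \<Rightarrow> bool" where
  "field_test A \<longleftrightarrow> (\<forall>a \<mu>. ftest (A a \<mu>))"

definition field_vary :: "field \<Rightarrow> real \<Rightarrow> field \<Rightarrow> field" where
  "field_vary A s \<Phi> a \<mu> x = A a \<mu> x + fps_const s * \<Phi> a \<mu> x"

lemma pairing_eq: "pairing J A = fint (field_dot J A)"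
  by (simp add: pairing_def field_dot_def[abs_def])

lemma field_dot_commute: "field_dot A E x = field_dot E A x"
  by (simp add: field_dot_def mult.commute)

lemma field_dot_add_right: "field_dot A (\<lambda>a \<mu> x. E a \<mu> x + F a \<mu> x) x = field_dot A E x + field_dot A F x"
  and field_dot_diff_right: "field_dot A (\<lambda>a \<mu> x. E a \<mu> x - F a \<mu> x) x = field_dot A E x - field_dot A F x"
  and field_dot_uminus_right: "field_dot A (\<lambda>a \<mu> x. - E a \<mu> x) x = - field_dot A E x"
  and field_dot_cmult_right: "field_dot A (\<lambda>a \<mu> x. c * E a \<mu> x) x = c * field_dot A E x"
  by (simp_all add: field_dot_def algebra_simps sum.distrib sum_subtractf sum_negf sum_distrib_left)

lemma field_dot_vary_left: "field_dot (field_vary A s \<Phi>) E x = field_dot A E x + fps_const s * field_dot \<Phi> E x"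
  and field_dot_vary_right: "field_dot E (field_vary A s \<Phi>) x = field_dot E A x + fps_const s * field_dot E \<Phi> x"
  by (simp_all add: field_dot_def field_vary_def algebra_simps sum.distrib sum_distrib_left)

lemma field_curl_vary:
  "field_smooth A \<Longrightarrow> field_smooth \<Phi> \<Longrightarrow> field_curl (field_vary A s \<Phi>) = field_vary (field_curl A) s (field_curl \<Phi>)"
  by (simp add: fun_eq_iff field_curl_def field_vary_def[abs_def] field_smooth_def fpartial_add fpartial_cmult
      fsmooth_intros algebra_simps sum.distrib sum_distrib_left)

lemma field_bracket_vary_left:
  "field_bracket (field_vary A s \<Phi>) B = field_vary (field_bracket A B) s (field_bracket \<Phi> B)"
  by (simp add: fun_eq_iff field_bracket_def field_vary_def algebra_simps sum.distrib sum_distrib_left)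

text \<open>Exchanging the arguments swaps both index pairs; each Levi-Civita symbol changes sign,
  and the two signs cancel.\<close>

lemma field_bracket_commute: "field_bracket A B = field_bracket B A"
proof (intro ext)
  fix a \<mu> x
  have "field_bracket B A a \<mu> x =
    (\<Sum>\<kappa>\<in>UNIV. \<Sum>\<nu>\<in>UNIV. \<Sum>c\<in>UNIV. \<Sum>b\<in>UNIV.
        fps_const (levi_civita \<mu> \<kappa> \<nu>) * fps_const (levi_civita a c b) * (B c \<kappa> x * A b \<nu> x))"
    by (simp add: field_bracket_def)
  also have "\<dots> = (\<Sum>\<nu>\<in>UNIV. \<Sum>\<kappa>\<in>UNIV. \<Sum>b\<in>UNIV. \<Sum>c\<in>UNIV.
        fps_const (levi_civita \<mu> \<kappa> \<nu>) * fps_const (levi_civita a c b) * (B c \<kappa> x * A b \<nu> x))"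
    by (rule trans[OF sum.swap], rule sum.cong[OF refl], rule sum.cong[OF refl], rule sum.swap)
  also have "\<dots> = field_bracket A B a \<mu> x"
    unfolding field_bracket_def
  proof (intro sum.cong refl)
    fix \<nu> \<kappa> b c
    show "fps_const (levi_civita \<mu> \<kappa> \<nu>) * fps_const (levi_civita a c b) * (B c \<kappa> x * A b \<nu> x) =
        fps_const (levi_civita \<mu> \<nu> \<kappa>) * fps_const (levi_civita a b c) * (A b \<nu> x * B c \<kappa> x)"
      using levi_civita_swap(2)[of \<mu> \<nu> \<kappa>] levi_civita_swap(2)[of a b c] by (simp add: mult.commute)
  qed
  finally show "field_bracket A B a \<mu> x = field_bracket B A a \<mu> x" by simp
qed

text \<open>Turns the symbol into the series 0, 1 or -1, so that expanded index sums become
  identities in a commutative ring.\<close>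

lemma fps_const_levi_civita:
  "fps_const (levi_civita a b c) =
     (if (a, b, c) \<in> {(1, 2, 3), (2, 3, 1), (3, 1, 2)} then 1
      else if (a, b, c) \<in> {(1, 3, 2), (3, 2, 1), (2, 1, 3)} then -1 else 0)"
  by (simp add: levi_civita_def fps_const_neg[symmetric] del: fps_const_neg)

text \<open>With \<open>field_bracket_commute\<close> this makes the dot product of a field with a
  bracket a totally symmetric trilinear form, which collects the mixed terms of the
  variations.\<close>

lemma field_dot_bracket_swap:
  "field_dot A (field_bracket B C) x = field_dot B (field_bracket A C) x"
  by (simp add: field_dot_def field_bracket_def sum_3 fps_const_levi_civita algebra_simps)

section \<open>The Lagrangians and their variations\<close>

definition field_eom :: "field \<Rightarrow> field" where
  "field_eom A a \<mu> x = field_curl A a \<mu> x - fps_const (1/2) * field_bracket A A a \<mu> x"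

text \<open>Contraction with the antisymmetric symbol makes the two derivative terms of the
  curvature equal, so the factor 1/2 leaves one full curl, while the quadratic term keeps its
  1/2.\<close>

lemma curvature_dual:
  "(\<Sum>\<nu>\<in>UNIV. \<Sum>\<kappa>\<in>UNIV. fps_const (levi_civita \<mu> \<nu> \<kappa>) * (fps_const (1/2) * curvature A a \<nu> \<kappa> x))
    = field_eom A a \<mu> x"
proof -
  let ?h = "fps_const (1/2) :: real fps"
  have h: "?h * f + ?h * f = f" for f
    by (simp add: fps_eq_iff)
  have "(\<Sum>\<nu>\<in>UNIV. \<Sum>\<kappa>\<in>UNIV. fps_const (levi_civita \<mu> \<nu> \<kappa>) * fpartial \<kappa> (A a \<nu>) x)
      = (\<Sum>\<nu>\<in>UNIV. \<Sum>\<kappa>\<in>UNIV. fps_const (levi_civita \<mu> \<kappa> \<nu>) * fpartial \<nu> (A a \<kappa>) x)"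
    by (rule sum.swap)
  also have "\<dots> = - field_curl A a \<mu> x"
    unfolding field_curl_def sum_negf[symmetric]
  proof (intro sum.cong refl)
    fix \<nu> \<kappa>
    show "fps_const (levi_civita \<mu> \<kappa> \<nu>) * fpartial \<nu> (A a \<kappa>) x
        = - (fps_const (levi_civita \<mu> \<nu> \<kappa>) * fpartial \<nu> (A a \<kappa>) x)"
      using levi_civita_swap(2)[of \<mu> \<nu> \<kappa>] by (simp flip: fps_const_neg)
  qed
  finally have swap: "(\<Sum>\<nu>\<in>UNIV. \<Sum>\<kappa>\<in>UNIV. fps_const (levi_civita \<mu> \<nu> \<kappa>) * fpartial \<kappa> (A a \<nu>) x)
      = - field_curl A a \<mu> x" .
  have "(\<Sum>\<nu>\<in>UNIV. \<Sum>\<kappa>\<in>UNIV. fps_const (levi_civita \<mu> \<nu> \<kappa>) * (?h * curvature A a \<nu> \<kappa> x))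
      = ?h * (\<Sum>\<nu>\<in>UNIV. \<Sum>\<kappa>\<in>UNIV. fps_const (levi_civita \<mu> \<nu> \<kappa>) * fpartial \<nu> (A a \<kappa>) x)
        - ?h * (\<Sum>\<nu>\<in>UNIV. \<Sum>\<kappa>\<in>UNIV. fps_const (levi_civita \<mu> \<nu> \<kappa>) * fpartial \<kappa> (A a \<nu>) x)
        - ?h * field_bracket A A a \<mu> x"
    by (simp add: curvature_def field_bracket_def right_diff_distrib sum_subtractf sum_distrib_left
        mult_ac del: fps_const_mult)
  then show ?thesis
    unfolding swap by (simp add: field_eom_def field_curl_def[symmetric] h)
qed

lemma bf_density_eq: "bf_density A B x = field_dot B (field_eom A) x"
  by (simp add: bf_density_def field_dot_def curvature_dual[symmetric] sum_3 fps_const_levi_civita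
      algebra_simps del: fps_const_mult)

lemma cs_density_eq:
  "cs_density A x = fps_const (1/2) * field_dot A (field_curl A) x
     - fps_const (1/6) * field_dot A (field_bracket A A) x"
  by (simp add: cs_density_def field_dot_def field_curl_def field_bracket_def sum_3
      fps_const_levi_civita algebra_simps del: fps_const_mult fps_const_neg)

text \<open>The vector identity div (C x A) = A . curl C - C . curl A, summed over colours.\<close>

lemma field_dot_curl_divergence:
  assumes "field_smooth A" "field_smooth C"
  shows "field_dot A (field_curl C) x - field_dot C (field_curl A) x =
    (\<Sum>\<nu>\<in>UNIV. fpartial \<nu> (\<lambda>x. \<Sum>a\<in>UNIV. \<Sum>\<mu>\<in>UNIV. \<Sum>\<kappa>\<in>UNIV.
      fps_const (levi_civita \<mu> \<nu> \<kappa>) * (A a \<mu> x * C a \<kappa> x)) x)"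
  using assms
  by (simp add: field_smooth_def fpartial_sum fpartial_cmult fpartial_mult fsmooth_intros)
    (simp add: field_dot_def field_curl_def sum_3 fps_const_levi_civita algebra_simps)

lemma field_test_imp_smooth: "field_test A \<Longrightarrow> field_smooth A"
  by (simp add: field_test_def field_smooth_def ftest_imp_fsmooth)

lemma field_smooth_curl: "field_smooth A \<Longrightarrow> field_smooth (field_curl A)"
  by (auto simp: field_smooth_def field_curl_def[abs_def] intro!: fsmooth_intros)

lemma field_smooth_bracket: "field_smooth A \<Longrightarrow> field_smooth B \<Longrightarrow> field_smooth (field_bracket A B)"
  by (auto simp: field_smooth_def field_bracket_def[abs_def] intro!: fsmooth_intros)

lemma field_smooth_eom: "field_smooth A \<Longrightarrow> field_smooth (field_eom A)"
  using field_smooth_curl[of A] field_smooth_bracket[of A A]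
  by (auto simp: field_smooth_def field_eom_def[abs_def] intro!: fsmooth_intros)

lemma field_test_curl: "field_test A \<Longrightarrow> field_test (field_curl A)"
  by (auto simp: field_test_def field_curl_def[abs_def]
      intro!: ftest_sum ftest_mult_right ftest_fpartial fsmooth_const)

lemma ftest_field_dot: "field_test \<Phi> \<Longrightarrow> field_smooth A \<Longrightarrow> ftest (field_dot \<Phi> A)"
  by (auto simp: field_test_def field_smooth_def field_dot_def[abs_def] intro!: ftest_sum ftest_mult_left)

lemma ftest_field_dot_right: "field_smooth A \<Longrightarrow> field_test \<Phi> \<Longrightarrow> ftest (field_dot A \<Phi>)"
  by (metis ext field_dot_commute ftest_field_dot)

text \<open>Integration by parts: the two densities differ by the divergence of \<open>V\<close>,
  which has bounded support because \<open>\<Phi>\<close> is a factor of it.\<close>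

lemma fint_field_dot_curl_swap:
  assumes A: "field_smooth A" and \<Phi>: "field_test \<Phi>"
  shows "fint (field_dot A (field_curl \<Phi>)) = fint (field_dot \<Phi> (field_curl A))"
proof -
  define V where "V \<nu> x = (\<Sum>a\<in>UNIV. \<Sum>\<mu>\<in>UNIV. \<Sum>\<kappa>\<in>UNIV.
      fps_const (levi_civita \<mu> \<nu> \<kappa>) * (A a \<mu> x * \<Phi> a \<kappa> x))" for \<nu> x
  have V: "ftest (V \<nu>)" for \<nu>
    using assms unfolding V_def[abs_def] field_test_def field_smooth_def
    by (auto intro!: ftest_sum ftest_mult_right fsmooth_const)
  have "fint (field_dot A (field_curl \<Phi>)) - fint (field_dot \<Phi> (field_curl A))
      = fint (\<lambda>x. field_dot A (field_curl \<Phi>) x - field_dot \<Phi> (field_curl A) x)"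
    using assms by (intro fint_diff[symmetric] ftest_fintegrable ftest_field_dot_right ftest_field_dot
        field_test_curl field_smooth_curl)
  also have "\<dots> = fint (\<lambda>x. \<Sum>\<nu>\<in>UNIV. fpartial \<nu> (V \<nu>) x)"
    using assms by (simp add: field_dot_curl_divergence field_test_imp_smooth V_def[abs_def])
  also have "\<dots> = (\<Sum>\<nu>\<in>UNIV. fint (fpartial \<nu> (V \<nu>)))"
    using V by (simp add: sum_3 fint_add fintegrable_add ftest_fintegrable ftest_fpartial)
  also have "\<dots> = 0"
    by (simp add: fint_fpartial_eq_0 V)
  finally show ?thesis by simp
qed

section \<open>Exact expansions of the Lagrangians along a variation\<close>

lemma field_dot_bracket_rotate: "field_dot B (field_bracket A \<Phi>) x = field_dot \<Phi> (field_bracket A B) x"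
  by (metis field_bracket_commute field_dot_bracket_swap)

lemma bf_density_vary_right:
  "bf_density A (field_vary B s \<Phi>) x = bf_density A B x + fps_const s * field_dot \<Phi> (field_eom A) x"
  by (simp add: bf_density_eq field_dot_vary_left)

lemma field_eom_dot:
  "field_dot B (field_eom A) x
    = field_dot B (field_curl A) x - fps_const (1/2) * field_dot B (field_bracket A A) x"
  unfolding field_eom_def[abs_def] by (simp add: field_dot_diff_right field_dot_cmult_right)

lemma field_bracket_vary_right:
  "field_bracket B (field_vary A s \<Phi>) = field_vary (field_bracket B A) s (field_bracket B \<Phi>)"
  by (simp add: field_bracket_commute[of B] field_bracket_vary_left)

text \<open>The density is quadratic in the connection. The two mixed bracket terms coincide by
  trilinear symmetry, which removes the factor 1/2 from the linear coefficient.\<close>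

lemma bf_density_vary_left:
  assumes "field_smooth A" "field_smooth \<Phi>"
  shows "bf_density (field_vary A s \<Phi>) B x = bf_density A B x
    + fps_const s * (field_dot B (field_curl \<Phi>) x - field_dot \<Phi> (field_bracket A B) x)
    + fps_const (s\<^sup>2) * (fps_const (-1/2) * field_dot \<Phi> (field_bracket \<Phi> B) x)"
proof -
  \<comment> \<open>The constants become ring elements known only through \<open>eqs\<close>, which
    leaves a polynomial identity for \<open>algebra\<close>.\<close>
  define h S :: "real fps" where "h = fps_const (1/2)" and "S = fps_const s"
  have eqs: "2 * h = 1" "fps_const (-1/2) = - h" "fps_const (s\<^sup>2) = S\<^sup>2"
    by (simp_all add: h_def S_def numeral_fps_const)
  have "field_dot B (field_bracket A \<Phi>) x = field_dot \<Phi> (field_bracket A B) x"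
    "field_dot B (field_bracket \<Phi> A) x = field_dot \<Phi> (field_bracket A B) x"
    "field_dot B (field_bracket \<Phi> \<Phi>) x = field_dot \<Phi> (field_bracket \<Phi> B) x"
    by (simp_all add: field_dot_bracket_rotate field_bracket_commute[of \<Phi> A])
  with eqs(1) show ?thesis
    unfolding bf_density_eq field_eom_dot field_curl_vary[OF assms] field_bracket_vary_left
      field_bracket_vary_right field_dot_vary_right eqs(2,3) h_def[symmetric] S_def[symmetric]
    by algebra
qed

text \<open>The linear coefficient is arranged as the dot product of \<open>\<Phi>\<close> with
  \<open>field_eom A\<close> plus half a difference of curl terms, because that difference is a
  divergence.\<close>

lemma cs_density_vary:
  assumes "field_smooth A" "field_smooth \<Phi>"
  shows "cs_density (field_vary A s \<Phi>) x = cs_density A x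
    + fps_const s * (field_dot \<Phi> (field_eom A) x
        + fps_const (1/2) * (field_dot A (field_curl \<Phi>) x - field_dot \<Phi> (field_curl A) x))
    + fps_const (s\<^sup>2) * (fps_const (1/2) *
        (field_dot \<Phi> (field_curl \<Phi>) x - field_dot \<Phi> (field_bracket \<Phi> A) x))
    + fps_const (s ^ 3) * (fps_const (-1/6) * field_dot \<Phi> (field_bracket \<Phi> \<Phi>) x)"
proof -
  define h k S :: "real fps" where "h = fps_const (1/2)" and "k = fps_const (1/6)" and "S = fps_const s"
  \<comment> \<open>The relation \<open>h = 3 * k\<close> accounts for the three equal terms that
    the symmetric cubic part contributes to each mixed order.\<close>
  have eqs: "2 * h = 1" "h = 3 * k" "fps_const (-1/6) = - k" "fps_const (s\<^sup>2) = S\<^sup>2" "fps_const (s ^ 3) = S ^ 3"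
    by (simp_all add: h_def k_def S_def numeral_fps_const)
  have "field_dot A (field_bracket A \<Phi>) x = field_dot \<Phi> (field_bracket A A) x"
    "field_dot A (field_bracket \<Phi> A) x = field_dot \<Phi> (field_bracket A A) x"
    "field_dot A (field_bracket \<Phi> \<Phi>) x = field_dot \<Phi> (field_bracket \<Phi> A) x"
    "field_dot \<Phi> (field_bracket A \<Phi>) x = field_dot \<Phi> (field_bracket \<Phi> A) x"
    by (rule field_dot_bracket_rotate, subst field_bracket_commute, rule field_dot_bracket_rotate,
        rule field_dot_bracket_rotate, simp add: field_bracket_commute[of A \<Phi>])
  with eqs(1,2) show ?thesis
    unfolding cs_density_eq field_eom_dot field_curl_vary[OF assms] field_bracket_vary_left
      field_bracket_vary_right field_dot_vary_left field_dot_vary_right eqs(3-) h_def[symmetric]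
      k_def[symmetric] S_def[symmetric]
    by algebra
qed

section \<open>Separation of fields by test variations\<close>

abbreviation const_field :: "(3 \<Rightarrow> 3 \<Rightarrow> real^3 \<Rightarrow> real) \<Rightarrow> field" where
  "const_field \<phi> \<equiv> \<lambda>a \<mu> x. fps_const (\<phi> a \<mu> x)"

lemma field_test_const_field:
  assumes "test_field \<phi>"
  shows "field_test (const_field \<phi>)"
proof -
  have "smooth (\<lambda>x. fps_nth (fps_const (\<phi> a \<mu> x)) n) \<and> bounded {x. fps_nth (fps_const (\<phi> a \<mu> x)) n \<noteq> 0}"
    for a \<mu> n
    using assms by (cases n) (auto simp: test_field_def)
  then show ?thesis
    by (simp add: field_test_def ftest_def fsmooth_def)
qed

text \<open>Test fields are free of \<open>t\<close>, so the pairing at order \<open>n\<close> sees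
  only the coefficient of \<open>E\<close> at order \<open>n\<close>, and the scalar fundamental
  lemma applies to each component.\<close>

lemma field_dot_eq_0_imp_eq_0:
  assumes E: "field_smooth E"
    and zero: "\<And>\<phi>. test_field \<phi> \<Longrightarrow> fint (field_dot (const_field \<phi>) E) = 0"
  shows "E a \<mu> x = 0"
proof (rule fps_ext)
  fix n
  have "fps_nth (E a \<mu> x) n = 0"
  proof (rule fundamental_lemma[where E = "\<lambda>x. fps_nth (E a \<mu> x) n"])
    show "continuous_on UNIV (\<lambda>x. fps_nth (E a \<mu> x) n)"
      using E by (auto simp: field_smooth_def fsmooth_def intro: smooth_continuous)
    fix \<beta> assume \<beta>: "smooth \<beta>" "bounded {x. \<beta> x \<noteq> 0}"
    \<comment> \<open>Concentrated in one component, so that the double sum reduces to a single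
      term.\<close>
    define \<phi> where "\<phi> a' \<mu>' x = (if a' = a then if \<mu>' = \<mu> then \<beta> x else 0 else 0)" for a' \<mu>' x
    have "test_field \<phi>"
    proof -
      have "\<phi> a' \<mu>' = (if a' = a \<and> \<mu>' = \<mu> then \<beta> else (\<lambda>x. 0))" for a' \<mu>'
        by (simp add: fun_eq_iff \<phi>_def)
      with \<beta> show ?thesis by (simp add: test_field_def)
    qed
    moreover have "field_dot (const_field \<phi>) E x = fps_const (\<beta> x) * E a \<mu> x" for x
    proof -
      have "field_dot (const_field \<phi>) E x
          = (\<Sum>a'\<in>UNIV. \<Sum>\<mu>'\<in>UNIV. if \<mu>' = \<mu> then if a' = a then fps_const (\<beta> x) * E a \<mu> x else 0 else 0)"
        unfolding field_dot_def by (intro sum.cong refl) (auto simp: \<phi>_def)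
      then show ?thesis by simp
    qed
    then have "field_dot (const_field \<phi>) E = (\<lambda>x. fps_const (\<beta> x) * E a \<mu> x)"
      by (rule ext)
    ultimately have "fps_nth (fint (\<lambda>x. fps_const (\<beta> x) * E a \<mu> x)) n = 0"
      using zero[of \<phi>] by simp
    then show "(LINT x|lborel. fps_nth (E a \<mu> x) n * \<beta> x) = 0"
      by (simp add: fint_nth mult.commute)
  qed
  then show "fps_nth (E a \<mu> x) n = fps_nth 0 n" by simp
qed

lemma field_eq_of_fint_eq:
  assumes "field_smooth E" "field_smooth F"
    and "\<And>\<phi>. test_field \<phi> \<Longrightarrow> fint (field_dot (const_field \<phi>) E) = fint (field_dot (const_field \<phi>) F)"
  shows "E a \<mu> x = F a \<mu> x"
proof -
  have "E a \<mu> x - F a \<mu> x = 0"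
  proof (rule field_dot_eq_0_imp_eq_0[where E = "\<lambda>a \<mu> x. E a \<mu> x - F a \<mu> x"])
    show "field_smooth (\<lambda>a \<mu> x. E a \<mu> x - F a \<mu> x)"
      using assms by (simp add: field_smooth_def fsmooth_diff)
    show "fint (field_dot (const_field \<phi>) (\<lambda>a \<mu> x. E a \<mu> x - F a \<mu> x)) = 0" if "test_field \<phi>" for \<phi>
    proof -
      have "field_dot (const_field \<phi>) (\<lambda>a \<mu> x. E a \<mu> x - F a \<mu> x)
          = (\<lambda>x. field_dot (const_field \<phi>) E x - field_dot (const_field \<phi>) F x)"
        by (rule ext) (rule field_dot_diff_right)
      then show ?thesis
        using assms that by (simp add: fint_diff ftest_fintegrable ftest_field_dot field_test_const_field)
    qed
  qed
  then show ?thesis by simp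
qed

section \<open>Functional derivatives of the actions\<close>

text \<open>The actions are polynomials of degree at most three in \<open>s\<close>, so the
  derivative at 0 is the linear coefficient, and uniqueness of derivatives gives the equivalence.
  One direction extracts the equations of motion, the other yields the Chern-Simons
  equation.\<close>

lemma has_functional_derivative_cubic:
  assumes S: "\<And>\<phi>. test_field \<phi> \<Longrightarrow> \<exists>c0 c2 c3. \<forall>s. S (field_vary A s (const_field \<phi>)) =
      c0 + fps_const s * fint (field_dot (const_field \<phi>) F) + fps_const (s\<^sup>2) * c2 + fps_const (s ^ 3) * c3"
  shows "has_functional_derivative S A E \<longleftrightarrow> (\<forall>\<phi>. test_field \<phi> \<longrightarrow>
    fint (field_dot (const_field \<phi>) F) = fint (field_dot (const_field \<phi>) E))"
proof -
  have vary: "(\<lambda>a \<mu> x. A a \<mu> x + fps_const (s * \<phi> a \<mu> x)) = field_vary A s (const_field \<phi>)" for s \<phi>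
    by (simp add: fun_eq_iff field_vary_def)
  have "field_dot E (const_field \<phi>) = field_dot (const_field \<phi>) E" for \<phi>
    by (rule ext) (rule field_dot_commute)
  then have pair: "pairing E (const_field \<phi>) = fint (field_dot (const_field \<phi>) E)" for \<phi>
    by (simp add: pairing_eq)
  have der: "((\<lambda>s. fps_nth (S (field_vary A s (const_field \<phi>))) n) has_real_derivative
      fps_nth (fint (field_dot (const_field \<phi>) F)) n) (at 0)" if \<phi>: "test_field \<phi>" for \<phi> n
  proof -
    obtain c0 c2 c3 where "\<And>s. S (field_vary A s (const_field \<phi>)) =
      c0 + fps_const s * fint (field_dot (const_field \<phi>) F) + fps_const (s\<^sup>2) * c2 + fps_const (s ^ 3) * c3"
      using S[OF \<phi>] by blast
    then show ?thesis
      by simp (auto intro!: derivative_eq_intros)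
  qed
  have "((\<lambda>s. fps_nth (S (field_vary A s (const_field \<phi>))) n) has_real_derivative e) (at 0)
      \<longleftrightarrow> fps_nth (fint (field_dot (const_field \<phi>) F)) n = e" if "test_field \<phi>" for \<phi> n e
    using der[OF that, of n] DERIV_unique by blast
  then show ?thesis
    unfolding has_functional_derivative_def vary pair by (auto simp: fps_eq_iff)
qed

lemma BF_action_vary_right:
  assumes A: "field_smooth A" and \<Phi>: "field_test \<Phi>" and int: "fintegrable (bf_density A B)"
  shows "\<exists>c0 c2 c3. \<forall>s. BF_action g A (field_vary B s \<Phi>) =
    c0 + fps_const s * fint (field_dot \<Phi> (field_eom A)) + fps_const (s\<^sup>2) * c2 + fps_const (s ^ 3) * c3"
proof -
  have "fintegrable (\<lambda>x. fps_const s * field_dot \<Phi> (field_eom A) x)" for s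
    using A \<Phi> by (intro fintegrable_cmult ftest_fintegrable ftest_field_dot field_smooth_eom)
  then have vary: "BF_action g A (field_vary B s \<Phi>) = BF_action g A B
      + fps_const s * fint (field_dot \<Phi> (field_eom A))" for s
    using int unfolding BF_action_def bf_density_vary_right[abs_def]
    by (simp add: fint_add fint_cmult)
  show ?thesis
    by (rule exI[of _ "BF_action g A B"], (rule exI[of _ 0])+) (simp add: vary)
qed

text \<open>The integral splits because the unvaried density is integrable by assumption and every
  correction has bounded support. Integration by parts moves the curl from \<open>\<Phi>\<close> to
  \<open>B\<close>.\<close>

lemma fint_bf_density_vary_left:
  assumes A: "field_smooth A" and B: "field_smooth B" and \<Phi>: "field_test \<Phi>"
    and int: "fintegrable (bf_density A B)"
  shows "fint (bf_density (field_vary A s \<Phi>) B) = fint (bf_density A B)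
    + fps_const s * (fint (field_dot \<Phi> (field_curl B)) - fint (field_dot \<Phi> (field_bracket A B)))
    + fps_const (s\<^sup>2) * fint (\<lambda>x. fps_const (-1/2) * field_dot \<Phi> (field_bracket \<Phi> B) x)"
proof -
  note \<Phi>s = field_test_imp_smooth[OF \<Phi>]
  have i1: "fintegrable (field_dot B (field_curl \<Phi>))"
    using B \<Phi> by (intro ftest_fintegrable ftest_field_dot_right field_test_curl)
  have i2: "fintegrable (field_dot \<Phi> (field_bracket A B))" "fintegrable (field_dot \<Phi> (field_bracket \<Phi> B))"
    using A B \<Phi> \<Phi>s by (auto intro!: ftest_fintegrable ftest_field_dot field_smooth_bracket)
  have i3: "fintegrable (\<lambda>x. field_dot B (field_curl \<Phi>) x - field_dot \<Phi> (field_bracket A B) x)"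
    using i1 i2 by (simp add: fintegrable_def)
  show ?thesis
    unfolding bf_density_vary_left[OF A \<Phi>s, abs_def]
    using int i1 i2 i3
    by (simp add: fint_add fint_cmult fint_diff fintegrable_add fintegrable_cmult
        fint_field_dot_curl_swap[OF B \<Phi>] del: fps_const_neg)
qed

lemma CS_action_vary:
  assumes A: "field_smooth A" and \<Phi>: "field_test \<Phi>" and int: "fintegrable (cs_density A)"
  shows "\<exists>c0 c2 c3. \<forall>s. CS_action (field_vary A s \<Phi>) =
    c0 + fps_const s * fint (field_dot \<Phi> (field_eom A)) + fps_const (s\<^sup>2) * c2 + fps_const (s ^ 3) * c3"
proof -
  note \<Phi>s = field_test_imp_smooth[OF \<Phi>]
  let ?f1 = "field_dot \<Phi> (field_eom A)"
  let ?f2 = "\<lambda>x. fps_const (1/2) * (field_dot A (field_curl \<Phi>) x - field_dot \<Phi> (field_curl A) x)"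
  let ?f3 = "\<lambda>x. fps_const (1/2) * (field_dot \<Phi> (field_curl \<Phi>) x - field_dot \<Phi> (field_bracket \<Phi> A) x)"
  let ?f4 = "\<lambda>x. fps_const (-1/6) * field_dot \<Phi> (field_bracket \<Phi> \<Phi>) x"
  have i: "fintegrable (field_dot A (field_curl \<Phi>))" "fintegrable (field_dot \<Phi> (field_curl A))"
    using A \<Phi> by (blast intro: ftest_fintegrable ftest_field_dot_right ftest_field_dot
        field_test_curl field_smooth_curl)+
  have 1: "fintegrable ?f1"
    using A \<Phi> by (intro ftest_fintegrable ftest_field_dot field_smooth_eom)
  have 2: "fintegrable ?f2"
    using i by (intro fintegrable_cmult) (simp add: fintegrable_def)
  have 3: "fintegrable ?f3"
    using A \<Phi> \<Phi>s by (intro fintegrable_cmult ftest_fintegrable ftest_diff ftest_field_dot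
        field_smooth_curl field_smooth_bracket)
  have 4: "fintegrable ?f4"
    using \<Phi> \<Phi>s by (intro fintegrable_cmult ftest_fintegrable ftest_field_dot field_smooth_bracket)
  \<comment> \<open>The divergence part of the linear coefficient drops out by integration by
    parts.\<close>
  have zero: "fint ?f2 = 0"
    using i by (simp only: fint_cmult fint_diff fint_field_dot_curl_swap[OF A \<Phi>]) simp
  have "CS_action (field_vary A s \<Phi>) = fint (cs_density A) + fps_const s * fint ?f1
      + fps_const (s\<^sup>2) * fint ?f3 + fps_const (s ^ 3) * fint ?f4" for s
  proof -
    have vary: "CS_action (field_vary A s \<Phi>) = fint (\<lambda>x. cs_density A x + fps_const s * (?f1 x + ?f2 x)
        + fps_const (s\<^sup>2) * ?f3 x + fps_const (s ^ 3) * ?f4 x)"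
      unfolding CS_action_def cs_density_vary[OF A \<Phi>s, abs_def] ..
    have "fint (\<lambda>x. cs_density A x + fps_const s * (?f1 x + ?f2 x)
        + fps_const (s\<^sup>2) * ?f3 x + fps_const (s ^ 3) * ?f4 x)
        = fint (cs_density A) + fps_const s * (fint ?f1 + fint ?f2)
        + fps_const (s\<^sup>2) * fint ?f3 + fps_const (s ^ 3) * fint ?f4"
      \<comment> \<open>The instances of \<open>fint_cmult\<close> are fixed so that only the powers
        of \<open>s\<close> are pulled out, not the constants inside \<open>?f3\<close> and
        \<open>?f4\<close>.\<close>
      using int 1 2 3 4 by (simp only: fint_add fintegrable_add fintegrable_cmult fint_cmult[of _ ?f3]
          fint_cmult[of _ ?f4] fint_cmult[of _ "\<lambda>x. ?f1 x + ?f2 x"])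
    then show ?thesis
      by (simp only: vary zero add_0_right)
  qed
  then show ?thesis by blast
qed

text \<open>Keeping \<open>field_eom A\<close> unexpanded in the linear coefficient allows the other
  equation of motion to be substituted for it later.\<close>

lemma BF_action_vary_left:
  assumes A: "field_smooth A" and B: "field_smooth B" and \<Phi>: "field_test \<Phi>"
    and int: "fintegrable (bf_density A B)" "fintegrable (cs_density A)"
  shows "\<exists>c0 c2 c3. \<forall>s. BF_action g (field_vary A s \<Phi>) B = c0
    + fps_const s * fint (field_dot \<Phi> (\<lambda>a \<mu> x. field_curl B a \<mu> x - field_bracket A B a \<mu> x
        + fps_const g * field_eom A a \<mu> x))
    + fps_const (s\<^sup>2) * c2 + fps_const (s ^ 3) * c3"
proof -
  note t = ftest_fintegrable[OF ftest_field_dot[OF \<Phi>]]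
  obtain c2 where bf: "fint (bf_density (field_vary A s \<Phi>) B) = fint (bf_density A B)
    + fps_const s * (fint (field_dot \<Phi> (field_curl B)) - fint (field_dot \<Phi> (field_bracket A B)))
    + fps_const (s\<^sup>2) * c2" for s
    using fint_bf_density_vary_left[OF A B \<Phi> int(1)] by metis
  obtain d0 d2 d3 where cs: "CS_action (field_vary A s \<Phi>) = d0
    + fps_const s * fint (field_dot \<Phi> (field_eom A)) + fps_const (s\<^sup>2) * d2 + fps_const (s ^ 3) * d3" for s
    using CS_action_vary[OF A \<Phi> int(2)] by metis
  have dot: "field_dot \<Phi> (\<lambda>a \<mu> x. field_curl B a \<mu> x - field_bracket A B a \<mu> x + fps_const g * field_eom A a \<mu> x)
    = (\<lambda>x. field_dot \<Phi> (field_curl B) x - field_dot \<Phi> (field_bracket A B) x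
        + fps_const g * field_dot \<Phi> (field_eom A) x)"
    by (simp add: fun_eq_iff field_dot_diff_right field_dot_add_right field_dot_cmult_right)
  have fint: "fint (\<lambda>x. field_dot \<Phi> (field_curl B) x - field_dot \<Phi> (field_bracket A B) x
        + fps_const g * field_dot \<Phi> (field_eom A) x) = fint (field_dot \<Phi> (field_curl B)) - fint (field_dot \<Phi> (field_bracket A B))
      + fps_const g * fint (field_dot \<Phi> (field_eom A))"
    using A B by (simp add: fint_diff fint_add fint_cmult fintegrable_diff fintegrable_cmult t
        field_smooth_curl field_smooth_bracket field_smooth_eom)
  show ?thesis
    unfolding dot fint
    by (rule exI[of _ "fint (bf_density A B) + fps_const g * d0"], rule exI[of _ "c2 + fps_const g * d2"],
        rule exI[of _ "fps_const g * d3"]) (simp only: BF_action_def bf cs algebra_simps simp_thms)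
qed

section \<open>Uniqueness of the classical fields\<close>

lemma perturbative_field_smooth: "perturbative_field A \<Longrightarrow> field_smooth A"
  by (simp add: perturbative_field_def field_smooth_def fsmooth_def)

lemma localized_source_smooth: "localized_source K \<Longrightarrow> field_smooth K"
  by (simp add: localized_source_def field_smooth_def fsmooth_def)

lemma field_smooth_uminus: "field_smooth K \<Longrightarrow> field_smooth (\<lambda>a \<mu> x. - K a \<mu> x)"
  by (simp add: field_smooth_def fsmooth_uminus)

lemma perturbative_field_tendsto_0:
  assumes "perturbative_field A"
  shows "((\<lambda>x. fps_nth (A a \<mu> x) n) \<longlongrightarrow> 0) at_infinity"
proof -
  have "(\<lambda>x. fps_nth (A a \<mu> x) n) \<in> O[at_infinity](\<lambda>x. 1 / (norm x)\<^sup>2)"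
    using assms by (simp add: perturbative_field_def)
  then obtain c where "\<forall>\<^sub>F x in at_infinity. norm (fps_nth (A a \<mu> x) n) \<le> c * norm (1 / (norm x)\<^sup>2)"
    by (rule landau_o.bigE)
  moreover have "((\<lambda>x::real^3. c * norm (1 / (norm x)\<^sup>2)) \<longlongrightarrow> 0) at_infinity"
  proof -
    have "((\<lambda>x::real^3. c * (inverse (norm x))\<^sup>2) \<longlongrightarrow> c * 0\<^sup>2) at_infinity"
      by (intro tendsto_intros tendsto_inverse_0_at_top filterlim_norm_at_top)
    then show ?thesis by (simp add: power_inverse divide_inverse)
  qed
  ultimately show ?thesis
    by (rule Lim_null_comparison)
qed

text \<open>Strong induction on the order in \<open>t\<close>, shared by both fields. The hypothesis
  \<open>curl\<close> records what the field equations provide: agreement at lower orders forces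
  equal curls at order \<open>n\<close>.\<close>

lemma perturbative_field_unique:
  assumes A: "perturbative_field A" "landau_gauge A"
    and A': "perturbative_field A'" "landau_gauge A'"
    and curl: "\<And>n a \<mu> x. (\<And>m a \<mu> x. m < n \<Longrightarrow> fps_nth (A a \<mu> x) m = fps_nth (A' a \<mu> x) m) \<Longrightarrow>
      fps_nth (field_curl A a \<mu> x) n = fps_nth (field_curl A' a \<mu> x) n"
  shows "A = A'"
proof -
  have "\<forall>a \<mu> x. fps_nth (A a \<mu> x) n = fps_nth (A' a \<mu> x) n" for n
  proof (induction n rule: less_induct)
    case (less n)
    show ?case
    proof (intro allI)
      fix a \<mu>0 x0
      define d where "d \<mu> x = fps_nth (A a \<mu> x) n - fps_nth (A' a \<mu> x) n" for \<mu> x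
      have sm: "smooth (\<lambda>x. fps_nth (A a \<mu> x) n)" "smooth (\<lambda>x. fps_nth (A' a \<mu> x) n)" for \<mu>
        using A A' by (auto simp: perturbative_field_def)
      have pd: "partial \<nu> (d \<mu>) x = fps_nth (fpartial \<nu> (A a \<mu>) x) n - fps_nth (fpartial \<nu> (A' a \<mu>) x) n"
        for \<mu> \<nu> x
        using partial_diff[OF sm] by (simp add: d_def[abs_def] fpartial_nth)
      have "d \<mu>0 x0 = 0"
      proof (rule curl_free_divergence_free_eq_0)
        show "smooth (d \<mu>)" for \<mu>
          unfolding d_def[abs_def] by (intro smooth_diff sm)
        have "fps_nth (field_curl A a \<mu> x) n = fps_nth (field_curl A' a \<mu> x) n" for \<mu> x
          using less by (intro curl) auto
        then have "(\<Sum>\<nu>\<in>UNIV. \<Sum>\<kappa>\<in>UNIV. levi_civita \<mu> \<nu> \<kappa> * partial \<nu> (d \<kappa>) x) = 0" for \<mu> x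
          by (simp add: field_curl_def fps_sum_nth pd right_diff_distrib sum_subtractf)
        \<comment> \<open>The three curl components are the three off-diagonal symmetry conditions
          on the derivatives of \<open>d\<close>.\<close>
        from this[of 1] this[of 2] this[of 3]
        have "\<forall>\<mu> \<nu>. partial \<nu> (d \<mu>) x = partial \<mu> (d \<nu>) x" for x
          unfolding forall_3 by (simp add: sum_3 levi_civita_def)
        then show "partial \<nu> (d \<mu>) x = partial \<mu> (d \<nu>) x" for \<mu> \<nu> x
          by blast
        have "fps_nth (\<Sum>\<mu>\<in>UNIV. fpartial \<mu> (A a \<mu>) x) n = 0" "fps_nth (\<Sum>\<mu>\<in>UNIV. fpartial \<mu> (A' a \<mu>) x) n = 0" for x
          using A A' by (simp_all add: landau_gauge_def)
        then show "(\<Sum>\<mu>\<in>UNIV. partial \<mu> (d \<mu>) x) = 0" for x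
          by (simp add: pd sum_subtractf fps_sum_nth)
        show "(d \<mu> \<longlongrightarrow> 0) at_infinity" for \<mu>
          using tendsto_diff[OF perturbative_field_tendsto_0[OF A(1)] perturbative_field_tendsto_0[OF A'(1)]]
          by (simp add: d_def[abs_def])
      qed
      then show "fps_nth (A a \<mu>0 x0) n = fps_nth (A' a \<mu>0 x0) n"
        by (simp add: d_def)
    qed
  qed
  then show ?thesis by (simp add: fun_eq_iff fps_eq_iff)
qed

text \<open>In the convolution only the two end terms involve order \<open>n\<close>, and they carry
  a vanishing factor of order 0.\<close>

lemma fps_mult_nth_cong_less:
  fixes f f' g g' :: "real fps"
  assumes "fps_nth f 0 = 0" "fps_nth f' 0 = 0" "fps_nth g 0 = 0" "fps_nth g' 0 = 0"
    and "\<And>m. m < n \<Longrightarrow> fps_nth f m = fps_nth f' m" "\<And>m. m < n \<Longrightarrow> fps_nth g m = fps_nth g' m"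
  shows "fps_nth (f * g) n = fps_nth (f' * g') n"
  unfolding fps_mult_nth
proof (rule sum.cong[OF refl])
  fix i assume "i \<in> {0..n}"
  then consider "i = 0" | "i = n" | "i < n" "n - i < n" by fastforce
  then show "fps_nth f i * fps_nth g (n - i) = fps_nth f' i * fps_nth g' (n - i)"
    using assms by cases auto
qed

lemma field_bracket_nth_cong:
  assumes "perturbative_field A" "perturbative_field A'" "perturbative_field B" "perturbative_field B'"
    and "\<And>m a \<mu> x. m < n \<Longrightarrow> fps_nth (A a \<mu> x) m = fps_nth (A' a \<mu> x) m"
    and "\<And>m a \<mu> x. m < n \<Longrightarrow> fps_nth (B a \<mu> x) m = fps_nth (B' a \<mu> x) m"
  shows "fps_nth (field_bracket A B a \<mu> x) n = fps_nth (field_bracket A' B' a \<mu> x) n"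
proof -
  have "fps_nth (A b \<nu> x * B c \<kappa> x) n = fps_nth (A' b \<nu> x * B' c \<kappa> x) n" for b c \<nu> \<kappa>
    by (rule fps_mult_nth_cong_less) (use assms in \<open>auto simp: perturbative_field_def\<close>)
  then show ?thesis
    by (simp add: field_bracket_def fps_sum_nth)
qed

section \<open>Local equations of motion and their consequences\<close>

lemma classical_solution_eom:
  assumes sol: "classical_solution g J K A B" and J: "localized_source J" and K: "localized_source K"
  shows "field_eom A = (\<lambda>a \<mu> x. - K a \<mu> x)"
    and "has_functional_derivative CS_action A (\<lambda>a \<mu> x. - K a \<mu> x)"
    and "field_curl B = (\<lambda>a \<mu> x. field_bracket A B a \<mu> x + fps_const g * K a \<mu> x - J a \<mu> x)"
proof -
  have A: "field_smooth A" and B: "field_smooth B"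
    and iBF: "fintegrable (bf_density A B)" and iCS: "fintegrable (cs_density A)"
    and varB: "has_functional_derivative (\<lambda>B'. BF_action g A B') B (\<lambda>a \<mu> x. - K a \<mu> x)"
    and varA: "has_functional_derivative (\<lambda>A'. BF_action g A' B) A (\<lambda>a \<mu> x. - J a \<mu> x)"
    using sol by (auto simp: classical_solution_def perturbative_field_smooth)
  note sJ = localized_source_smooth[OF J] and sK = localized_source_smooth[OF K]
  have eomK: "fint (field_dot (const_field \<phi>) (field_eom A))
      = fint (field_dot (const_field \<phi>) (\<lambda>a \<mu> x. - K a \<mu> x))" if "test_field \<phi>" for \<phi>
    using BF_action_vary_right[OF A field_test_const_field iBF] that
    by (intro iffD1[OF has_functional_derivative_cubic varB, rule_format])
  then have "field_eom A a \<mu> x = - K a \<mu> x" for a \<mu> x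
    by (intro field_eq_of_fint_eq[of "field_eom A" "\<lambda>a \<mu> x. - K a \<mu> x"] field_smooth_eom
        field_smooth_uminus A sK)
  then show eom: "field_eom A = (\<lambda>a \<mu> x. - K a \<mu> x)"
    by (simp add: fun_eq_iff)
  \<comment> \<open>The variation of the BF action in \<open>B\<close> and that of the Chern-Simons
    action in \<open>A\<close> share the linear coefficient given by \<open>field_eom A\<close>, so
    \<open>eomK\<close> serves again.\<close>
  show "has_functional_derivative CS_action A (\<lambda>a \<mu> x. - K a \<mu> x)"
    using CS_action_vary[OF A field_test_const_field iCS] eomK
    by (intro iffD2[OF has_functional_derivative_cubic[where F = "field_eom A"]]) simp_all
  let ?F = "\<lambda>a \<mu> x. field_curl B a \<mu> x - field_bracket A B a \<mu> x + fps_const g * field_eom A a \<mu> x"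
  have "fint (field_dot (const_field \<phi>) ?F) = fint (field_dot (const_field \<phi>) (\<lambda>a \<mu> x. - J a \<mu> x))"
    if "test_field \<phi>" for \<phi>
    using BF_action_vary_left[OF A B field_test_const_field iBF iCS] that
    by (intro iffD1[OF has_functional_derivative_cubic varA, rule_format])
  moreover have "field_smooth ?F"
    using field_smooth_curl[OF B] field_smooth_bracket[OF A B] field_smooth_eom[OF A]
    by (auto simp: field_smooth_def intro!: fsmooth_intros)
  ultimately have "?F a \<mu> x = - J a \<mu> x" for a \<mu> x
    by (intro field_eq_of_fint_eq[of ?F "\<lambda>a \<mu> x. - J a \<mu> x"] field_smooth_uminus sJ)
  \<comment> \<open>Substituting \<open>eom\<close> replaces the Chern-Simons contribution by
    \<open>- g K\<close>.\<close>
  then show "field_curl B = (\<lambda>a \<mu> x. field_bracket A B a \<mu> x + fps_const g * K a \<mu> x - J a \<mu> x)"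
    by (simp add: fun_eq_iff eom algebra_simps eq_diff_eq diff_eq_eq)
qed

text \<open>Coupling, first source and second field may differ between the two solutions; only
  \<open>K\<close> is shared. This is the sense in which the connection depends on \<open>K\<close>
  alone.\<close>

lemma classical_connection_unique:
  assumes sol: "classical_solution g J K A B" "localized_source J"
    and sol': "classical_solution g' J' K A' B'" "localized_source J'"
    and K: "localized_source K"
  shows "A = A'"
proof -
  have A: "perturbative_field A" "landau_gauge A" "perturbative_field A'" "landau_gauge A'"
    using sol sol' by (auto simp: classical_solution_def)
  have "field_eom A = field_eom A'"
    using classical_solution_eom(1)[OF sol K] classical_solution_eom(1)[OF sol' K] by simp
  then have curl: "field_curl A a \<mu> x - fps_const (1/2) * field_bracket A A a \<mu> x
      = field_curl A' a \<mu> x - fps_const (1/2) * field_bracket A' A' a \<mu> x" for a \<mu> x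
    unfolding field_eom_def[abs_def] by metis
  show ?thesis
  proof (rule perturbative_field_unique[OF A])
    fix n a \<mu> x
    assume "\<And>m a \<mu> x. m < n \<Longrightarrow> fps_nth (A a \<mu> x) m = fps_nth (A' a \<mu> x) m"
    then have "fps_nth (field_bracket A A a \<mu> x) n = fps_nth (field_bracket A' A' a \<mu> x) n"
      using A by (intro field_bracket_nth_cong) auto
    with arg_cong[OF curl[of a \<mu> x], of "\<lambda>f. fps_nth f n"]
    show "fps_nth (field_curl A a \<mu> x) n = fps_nth (field_curl A' a \<mu> x) n"
      by simp
  qed
qed

text \<open>Makes the definite description in \<open>classical_fields\<close> meaningful. Once the
  connections agree, the equation for \<open>B\<close> is affine, and its bracket term involves only
  lower orders of \<open>B\<close>.\<close>

lemma classical_solution_unique: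
  assumes sol: "classical_solution g J K A B" and sol': "classical_solution g J K A' B'"
    and J: "localized_source J" and K: "localized_source K"
  shows "A = A'" "B = B'"
proof -
  show AA: "A = A'"
    by (rule classical_connection_unique[OF sol J sol' J K])
  have B: "perturbative_field B" "landau_gauge B" "perturbative_field B'" "landau_gauge B'"
    and A: "perturbative_field A"
    using sol sol' by (auto simp: classical_solution_def)
  show "B = B'"
  proof (rule perturbative_field_unique[OF B])
    fix n a \<mu> x
    assume "\<And>m a \<mu> x. m < n \<Longrightarrow> fps_nth (B a \<mu> x) m = fps_nth (B' a \<mu> x) m"
    then have "fps_nth (field_bracket A B a \<mu> x) n = fps_nth (field_bracket A B' a \<mu> x) n"
      using A B by (intro field_bracket_nth_cong) auto
    then show "fps_nth (field_curl B a \<mu> x) n = fps_nth (field_curl B' a \<mu> x) n"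
      using classical_solution_eom(3)[OF sol J K] classical_solution_eom(3)[OF sol' J K]
      by (simp add: AA)
  qed
qed

text \<open>Placing \<open>Acl\<close> before \<open>g\<close>, \<open>J\<close> and the fields
  expresses the dependence on \<open>K\<close> alone.\<close>

theorem proposition2:
  "\<exists>Acl :: field \<Rightarrow> field. \<forall>(g::real) J K A B.
     localized_source J \<and> localized_source K \<and> classical_solution g J K A B \<longrightarrow>
       classical_fields g J K = (A, B) \<and>
       A = Acl K \<and>
       W0 g J K = fps_const g * CS_action A + pairing J A \<and>
       landau_gauge A \<and>
       has_functional_derivative CS_action A (\<lambda>a \<mu> x. - K a \<mu> x)"
proof -
  \<comment> \<open>For localized \<open>K\<close> there is at most one such connection, by
    \<open>classical_connection_unique\<close>, so the choice returns the given
    \<open>A\<close>.\<close>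
  define Acl :: "field \<Rightarrow> field" where
    "Acl K = (SOME A. \<exists>g J B. localized_source J \<and> classical_solution g J K A B)" for K
  have "classical_fields g J K = (A, B) \<and> A = Acl K \<and>
      W0 g J K = fps_const g * CS_action A + pairing J A \<and> landau_gauge A \<and>
      has_functional_derivative CS_action A (\<lambda>a \<mu> x. - K a \<mu> x)"
    if J: "localized_source J" and K: "localized_source K" and sol: "classical_solution g J K A B"
    for g J K A B
  proof (intro conjI)
    show fields: "classical_fields g J K = (A, B)"
      unfolding classical_fields_def
    proof (rule the_equality)
      show "case (A, B) of (A, B) \<Rightarrow> classical_solution g J K A B"
        using sol by simp
      fix p assume "case p of (A, B) \<Rightarrow> classical_solution g J K A B"
      then obtain A' B' where p: "p = (A', B')" and sol': "classical_solution g J K A' B'"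
        by (cases p) simp
      show "p = (A, B)"
        using classical_solution_unique[OF sol' sol J K] by (simp add: p)
    qed
    have "\<exists>g J B. localized_source J \<and> classical_solution g J K (Acl K) B"
      unfolding Acl_def by (rule someI[of _ A]) (use J sol in blast)
    then show "A = Acl K"
      using classical_connection_unique[OF sol J] K by blast
    \<comment> \<open>On solutions the BF Lagrangian is the negative source term pointwise, so its
      integral cancels \<open>pairing K B\<close> in \<open>W0\<close>.\<close>
    have "bf_density A B = (\<lambda>x. - field_dot K B x)"
      by (simp add: fun_eq_iff bf_density_eq classical_solution_eom(1)[OF sol J K] field_dot_uminus_right
          field_dot_commute[of B])
    then have "fint (bf_density A B) = - pairing K B"
      by (simp add: pairing_eq fint_uminus)
    then show "W0 g J K = fps_const g * CS_action A + pairing J A"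
      by (simp add: W0_def fields BF_action_def)
    show "landau_gauge A"
      using sol by (simp add: classical_solution_def)
    show "has_functional_derivative CS_action A (\<lambda>a \<mu> x. - K a \<mu> x)"
      by (rule classical_solution_eom(2)[OF sol J K])
  qed
  then show ?thesis by blast
qed

end
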